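(* A matrix $Q\in\mathfrak{H}_4^{\rm trop}$ lies in the tropical Igusa locus if and only if $\vartheta_v(Q)\ge0$ for all $v\in(\mathbb{Z}/2\mathbb{Z})^4\setminus\{0\}$. The tropical Igusa locus contains the tropical Schottky locus $\mathfrak{J}_4^{\rm trop}$, but the two loci are not equal.
   Context: $\mathfrak{H}_4^{\rm trop}$ is the cone of real symmetric positive definite $4\times4$ matrices. Tropical Schottky locus. A metric graph $\Gamma=(V,E,l)$ is a finite connected graph (loops and parallel edges allowed) with a length function $l:E\to\mathbb{R}_{>0}$; its genus is $g=|E|-|V|+1$. Orient the edges and fix a $\mathbb{Z}$-basis of $H_1(\Gamma,\mathbb{Z})\simeq\mathbb{Z}^g$. Let $B$ be the $g\times|E|$ matrix whose column for an edge $e$ records the coefficients of $e$ in the basis vectors, and let $D$ be the diagonal matrix of edge lengths. $\mathfrak{J}_4^{\rm trop}$ is the set of all matrices $BDB^t$ as $\Gamma$ runs over metric graphs of genus $4$ and $B$ over their cycle bases. Tropical theta constants. For $Q\in\mathfrak{H}_4^{\rm trop}$ and $x\in\mathbb{R}^4$ let $\Theta(Q,x)=\max_{\lambda\in\mathbb{Z}^4}\{\lambda^tQx-\frac12\lambda^tQ\lambda\}$. For $u\in\mathbb{Z}^4$ let $\Theta_u(Q)=2\,\Theta(Q,\frac u2)-\frac14u^tQu$, which depends only on $u$ modulo $2$. For $v\in(\mathbb{Z}/2\mathbb{Z})^4$ let $\vartheta_v(Q)=\sum_{u\in(\mathbb{Z}/2\mathbb{Z})^4}(-1)^{u^tv}\,\Theta_u(Q)$.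 Characteristics. Write $m\in(\mathbb{Z}/2\mathbb{Z})^8$ as $m=(m',m'')$ with $m',m''\in(\mathbb{Z}/2\mathbb{Z})^4$. The sign of $m$ is $e(m)=(-1)^{(m')^tm''}$; $m$ is even if $e(m)=1$ and odd if $e(m)=-1$. A triple $\{m_1,m_2,m_3\}\subset(\mathbb{Z}/2\mathbb{Z})^8$ is azygetic if $e(m_1)e(m_2)e(m_3)e(m_1+m_2+m_3)=-1$. For $M\subset(\mathbb{Z}/2\mathbb{Z})^8$ put $M'=\{m':m\in M\}$. A choice $(m_1,m_2,m_3,N)$ is admissible if $N\subset(\mathbb{Z}/2\mathbb{Z})^8$ is a subgroup of rank $3$, the triple $\{m_1,m_2,m_3\}$ is azygetic, all elements of $m_i+N$ are even for $i=1,2,3$, and the group $N'\subset(\mathbb{Z}/2\mathbb{Z})^4$ also has rank $3$. Tropical Igusa locus. For a choice $(m_1,m_2,m_3,N)$ and $i=1,2,3$ set $\pi_i^{\rm trop}(Q)=\sum_{m\in m_i+N}\Theta_{m'}(Q)$. The tropical Schottky–Igusa modular form is $$Q\mapsto\max_{1\le i\le j\le3}\bigl(\pi_i^{\rm trop}(Q)+\pi_j^{\rm trop}(Q)\bigr).$$ Its breakpoint locus is the set of $Q\in\mathfrak{H}_4^{\rm trop}$ for which this maximum is attained at least twice among the six index pairs $1\le i\le j\le 3$. The tropical Igusa locus is the intersection, over all admissible choices $(m_1,m_2,m_3,N)$, of these breakpoint loci. *)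

theory Defs
  imports "HOL-Analysis.Analysis" "HOL-Library.Z2" "Graph_Theory.Digraph_Component"
begin

section \<open>Positive definite matrices\<close>

definition H4_trop :: "(real ^ 4 ^ 4) set" where
  "H4_trop = {Q. transpose Q = Q \<and> (\<forall>x. x \<noteq> 0 \<longrightarrow> x \<bullet> (Q *v x) > 0)}"


section \<open>The tropical Schottky locus\<close>

text \<open>
  An oriented finite connected multigraph is a (finite, weakly connected) digraph with explicit
  arcs, so loops and parallel edges are allowed; the constant connected of Digraph_Component is
  connectedness of the underlying undirected graph, and it excludes the graph without vertices.
  The orientation of the metric graph is the one recorded by tail and head.
\<close>

definition metric_graph :: "('v, 'e) pre_digraph \<Rightarrow> ('e \<Rightarrow> real) \<Rightarrow> bool" where
  "metric_graph G l \<longleftrightarrow>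
     fin_digraph G \<and> Digraph_Component.connected G \<and> (\<forall>e\<in>arcs G. l e > 0)"

definition genus :: "('v, 'e) pre_digraph \<Rightarrow> int" where
  "genus G = int (card (arcs G)) - int (card (verts G)) + 1"

text \<open>
  The first homology group of a graph is the kernel of the boundary map on integral 1-chains.
  A chain is a function on edges that vanishes outside the edge set of the graph.
\<close>

definition H1 :: "('v, 'e) pre_digraph \<Rightarrow> ('e \<Rightarrow> int) set" where
  "H1 G = {c. (\<forall>e. e \<notin> arcs G \<longrightarrow> c e = 0) \<and>
              (\<forall>v\<in>verts G. (\<Sum>e\<in>in_arcs G v. c e) = (\<Sum>e\<in>out_arcs G v. c e))}"

definition cycle_basis :: "('v, 'e) pre_digraph \<Rightarrow> ('n::finite \<Rightarrow> 'e \<Rightarrow> int) \<Rightarrow> bool" where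
  "cycle_basis G B \<longleftrightarrow>
     (\<forall>i. B i \<in> H1 G) \<and>
     (\<forall>c\<in>H1 G. \<exists>!a :: 'n \<Rightarrow> int. c = (\<lambda>e. \<Sum>i\<in>UNIV. a i * B i e))"

text \<open>
  The matrix \<open>B D B\<^sup>t\<close>, where the rows of \<open>B\<close> are indexed by \<open>'n\<close> and its columns by the edges,
  and \<open>D\<close> is the diagonal matrix of edge lengths.
\<close>

definition riemann_matrix ::
  "('v, 'e) pre_digraph \<Rightarrow> ('e \<Rightarrow> real) \<Rightarrow> ('n::finite \<Rightarrow> 'e \<Rightarrow> int) \<Rightarrow> real ^ 'n ^ 'n" where
  "riemann_matrix G l B = (\<chi> i j. \<Sum>e\<in>arcs G. of_int (B i e) * l e * of_int (B j e))"

text \<open>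
  Every finite graph is isomorphic to one whose vertices and edges are natural numbers, and
  isomorphic metric graphs have the same matrices.
\<close>

definition J4_trop :: "(real ^ 4 ^ 4) set" where
  "J4_trop = {riemann_matrix G l B | (G :: (nat, nat) pre_digraph) l (B :: 4 \<Rightarrow> nat \<Rightarrow> int).
                metric_graph G l \<and> genus G = 4 \<and> cycle_basis G B}"


section \<open>Tropical theta constants\<close>

definition real_vec :: "int ^ 'n \<Rightarrow> real ^ 'n" where
  "real_vec u = (\<chi> i. of_int (u $ i))"

text \<open>
  For positive definite \<open>Q\<close> the supremum is a maximum; see \<open>Theta_attained\<close> below.
\<close>

definition Theta :: "real ^ 4 ^ 4 \<Rightarrow> real ^ 4 \<Rightarrow> real" where
  "Theta Q x = (SUP k :: int ^ 4.
     real_vec k \<bullet> (Q *v x) - 1/2 * (real_vec k \<bullet> (Q *v real_vec k)))"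

definition Theta_int :: "int ^ 4 \<Rightarrow> real ^ 4 ^ 4 \<Rightarrow> real" where
  "Theta_int u Q =
     2 * Theta Q ((1/2) *\<^sub>R real_vec u) - 1/4 * (real_vec u \<bullet> (Q *v real_vec u))"

text \<open>
  The value of \<open>Theta_int\<close> on a residue class modulo 2 is read off at the representative with
  entries 0 and 1; \<open>Theta_mod2_eq\<close> below shows that every representative gives the same value.
\<close>

definition lift_int :: "bit ^ 'n \<Rightarrow> int ^ 'n" where
  "lift_int u = (\<chi> i. of_bit (u $ i))"

definition Theta_mod2 :: "bit ^ 4 \<Rightarrow> real ^ 4 ^ 4 \<Rightarrow> real" where
  "Theta_mod2 u Q = Theta_int (lift_int u) Q"

definition dot2 :: "bit ^ 'n \<Rightarrow> bit ^ 'n \<Rightarrow> bit" where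
  "dot2 u v = (\<Sum>i\<in>UNIV. u $ i * v $ i)"

definition vartheta :: "bit ^ 4 \<Rightarrow> real ^ 4 ^ 4 \<Rightarrow> real" where
  "vartheta v Q = (\<Sum>u\<in>UNIV. (-1) ^ of_bit (dot2 u v) * Theta_mod2 u Q)"


section \<open>Characteristics\<close>

text \<open>
  Characteristics are vectors of length 8 over the two-element field, indexed by the disjoint sum
  \<open>4 + 4\<close>, so that the two halves \<open>m'\<close> and \<open>m''\<close> are the restrictions to the two summands.
\<close>

type_synonym characteristic = "bit ^ (4 + 4)"

definition fst_half :: "characteristic \<Rightarrow> bit ^ 4" where
  "fst_half m = (\<chi> i. m $ Inl i)"

definition snd_half :: "characteristic \<Rightarrow> bit ^ 4" where
  "snd_half m = (\<chi> i. m $ Inr i)"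

definition char_sign :: "characteristic \<Rightarrow> int" where
  "char_sign m = (-1) ^ of_bit (dot2 (fst_half m) (snd_half m))"

definition azygetic :: "characteristic \<Rightarrow> characteristic \<Rightarrow> characteristic \<Rightarrow> bool" where
  "azygetic m\<^sub>1 m\<^sub>2 m\<^sub>3 \<longleftrightarrow>
     char_sign m\<^sub>1 * char_sign m\<^sub>2 * char_sign m\<^sub>3 * char_sign (m\<^sub>1 + m\<^sub>2 + m\<^sub>3) = -1"

definition char_coset :: "characteristic \<Rightarrow> characteristic set \<Rightarrow> characteristic set" where
  "char_coset m N = (\<lambda>n. m + n) ` N"

text \<open>
  Subgroups of a vector space over the two-element field are the same as subspaces
  (\<open>subspace_bit_iff\<close> below), and the rank of such a group is its dimension.
  A triple \<open>m\<^sub>1, m\<^sub>2, m\<^sub>3\<close> is encoded as a function of which only the values at 1, 2, 3 matter;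
  the three entries of an azygetic triple are automatically distinct.
\<close>

definition admissible :: "(nat \<Rightarrow> characteristic) \<Rightarrow> characteristic set \<Rightarrow> bool" where
  "admissible m N \<longleftrightarrow>
     vec.subspace N \<and> vec.dim N = 3 \<and>
     azygetic (m 1) (m 2) (m 3) \<and>
     (\<forall>i\<in>{1..3}. \<forall>c\<in>char_coset (m i) N. char_sign c = 1) \<and>
     vec.dim (fst_half ` N) = 3"


section \<open>The tropical Igusa locus\<close>

definition pi_trop ::
  "(nat \<Rightarrow> characteristic) \<Rightarrow> characteristic set \<Rightarrow> nat \<Rightarrow> real ^ 4 ^ 4 \<Rightarrow> real" where
  "pi_trop m N i Q = (\<Sum>c\<in>char_coset (m i) N. Theta_mod2 (fst_half c) Q)"

definition index_pairs :: "(nat \<times> nat) set" where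
  "index_pairs = {(i, j). 1 \<le> i \<and> i \<le> j \<and> j \<le> 3}"

definition igusa_term ::
  "(nat \<Rightarrow> characteristic) \<Rightarrow> characteristic set \<Rightarrow> nat \<times> nat \<Rightarrow> real ^ 4 ^ 4 \<Rightarrow> real" where
  "igusa_term m N p Q = pi_trop m N (fst p) Q + pi_trop m N (snd p) Q"

definition igusa_form ::
  "(nat \<Rightarrow> characteristic) \<Rightarrow> characteristic set \<Rightarrow> real ^ 4 ^ 4 \<Rightarrow> real" where
  "igusa_form m N Q = Max ((\<lambda>p. igusa_term m N p Q) ` index_pairs)"

definition breakpoint_locus ::
  "(nat \<Rightarrow> characteristic) \<Rightarrow> characteristic set \<Rightarrow> (real ^ 4 ^ 4) set" where
  "breakpoint_locus m N =
     {Q \<in> H4_trop. \<exists>p\<in>index_pairs. \<exists>q\<in>index_pairs. p \<noteq> q \<and>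
        igusa_term m N p Q = igusa_form m N Q \<and> igusa_term m N q Q = igusa_form m N Q}"

definition igusa_locus :: "(real ^ 4 ^ 4) set" where
  "igusa_locus = {Q \<in> H4_trop. \<forall>m N. admissible m N \<longrightarrow> Q \<in> breakpoint_locus m N}"


section \<open>Well-definedness\<close>

lemma subspace_bit_iff:
  fixes N :: "(bit ^ 'n) set"
  shows "vec.subspace N \<longleftrightarrow> 0 \<in> N \<and> (\<forall>x\<in>N. \<forall>y\<in>N. x + y \<in> N) \<and> (\<forall>x\<in>N. - x \<in> N)"
proof
  assume "vec.subspace N"
  then show "0 \<in> N \<and> (\<forall>x\<in>N. \<forall>y\<in>N. x + y \<in> N) \<and> (\<forall>x\<in>N. - x \<in> N)"
    by (auto simp: vec.subspace_0 vec.subspace_add vec.subspace_neg)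
next
  assume N: "0 \<in> N \<and> (\<forall>x\<in>N. \<forall>y\<in>N. x + y \<in> N) \<and> (\<forall>x\<in>N. - x \<in> N)"
  have "c *s x \<in> N" if "x \<in> N" for c :: bit and x
    using N that by (cases c) auto
  with N show "vec.subspace N"
    by (auto simp: vec.subspace_def)
qed

lemma H4_trop_coercive:
  assumes "Q \<in> H4_trop"
  obtains c where "c > 0" "\<And>x. x \<bullet> (Q *v x) \<ge> c * (norm x)\<^sup>2"
proof -
  let ?f = "\<lambda>x::real^4. x \<bullet> (Q *v x)"
  have "continuous_on (sphere 0 1) ?f"
    by (intro continuous_intros linear_continuous_on matrix_vector_mul_bounded_linear)
  moreover have "compact (sphere (0::real^4) 1)" "sphere (0::real^4) 1 \<noteq> {}"
    by auto
  ultimately obtain z where z: "z \<in> sphere 0 1" "\<And>y. y \<in> sphere 0 1 \<Longrightarrow> ?f z \<le> ?f y"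
    using continuous_attains_inf[of "sphere 0 1" ?f] by blast
  have "z \<noteq> 0"
    using z(1) by auto
  then have "?f z > 0"
    using assms by (simp add: H4_trop_def)
  moreover have "?f x \<ge> ?f z * (norm x)\<^sup>2" for x
  proof (cases "x = 0")
    case False
    define y where "y = (1 / norm x) *\<^sub>R x"
    have x: "norm x *\<^sub>R y = x" using False by (simp add: y_def)
    have "?f (norm x *\<^sub>R y) = (norm x)\<^sup>2 * ?f y"
      by (simp add: matrix_vector_mult_scaleR power2_eq_square)
    then have "?f x = (norm x)\<^sup>2 * ?f y"
      unfolding x .
    moreover have "y \<in> sphere 0 1" using False by (simp add: y_def)
    ultimately show ?thesis
      using mult_left_mono[OF z(2)[of y], of "(norm x)\<^sup>2"] by (simp add: mult.commute)
  qed auto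
  ultimately show thesis using that by blast
qed

lemma finite_int_vec_bounded:
  "finite {k :: int ^ 'n. norm (real_vec k) \<le> r}"
proof (rule finite_subset)
  show "{k :: int ^ 'n. norm (real_vec k) \<le> r}
          \<subseteq> vec_lambda ` (UNIV \<rightarrow>\<^sub>E {- \<lceil>r\<rceil> .. \<lceil>r\<rceil>})"
  proof
    fix k :: "int ^ 'n"
    assume k: "k \<in> {k. norm (real_vec k) \<le> r}"
    have "k $ i \<in> {- \<lceil>r\<rceil> .. \<lceil>r\<rceil>}" for i
    proof -
      have "\<bar>real_of_int (k $ i)\<bar> \<le> r"
        using k component_le_norm_cart[of "real_vec k" i] by (simp add: real_vec_def)
      then show ?thesis
        unfolding atLeastAtMost_iff by linarith
    qed
    then have "($) k \<in> UNIV \<rightarrow>\<^sub>E {- \<lceil>r\<rceil> .. \<lceil>r\<rceil>}"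
      by auto
    then show "k \<in> vec_lambda ` (UNIV \<rightarrow>\<^sub>E {- \<lceil>r\<rceil> .. \<lceil>r\<rceil>})"
      by (metis image_eqI vec_nth_inverse)
  qed
qed (intro finite_imageI finite_PiE; simp)

lemma Theta_attained:
  assumes "Q \<in> H4_trop"
  obtains k where
    "Theta Q x = real_vec k \<bullet> (Q *v x) - 1/2 * (real_vec k \<bullet> (Q *v real_vec k))"
    "\<And>k'. real_vec k' \<bullet> (Q *v x) - 1/2 * (real_vec k' \<bullet> (Q *v real_vec k')) \<le> Theta Q x"
proof -
  define f where
    "f k = real_vec k \<bullet> (Q *v x) - 1/2 * (real_vec k \<bullet> (Q *v real_vec k))" for k :: "int ^ 4"
  obtain c where c: "c > 0" "\<And>y. y \<bullet> (Q *v y) \<ge> c * (norm y)\<^sup>2"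
    using H4_trop_coercive[OF assms] by blast
  define r where "r = 2 * norm (Q *v x) / c"
  have f0: "f 0 = 0" by (simp add: f_def real_vec_def zero_vec_def[symmetric])
  have "r \<ge> 0" using c(1) by (simp add: r_def)
  have neg: "f k \<le> 0" if "norm (real_vec k) > r" for k
  proof -
    let ?n = "norm (real_vec k)"
    have "f k \<le> ?n * norm (Q *v x) - 1/2 * (c * ?n\<^sup>2)"
      using c(2)[of "real_vec k"] norm_cauchy_schwarz[of "real_vec k" "Q *v x"]
      by (simp add: f_def)
    also have "\<dots> = ?n * (c / 2) * (r - ?n)"
      using c(1) by (simp add: r_def field_simps power2_eq_square)
    also have "\<dots> \<le> 0"
      using that c(1) by (intro mult_nonneg_nonpos) auto
    finally show ?thesis .
  qed
  let ?K = "{k :: int ^ 4. norm (real_vec k) \<le> r}"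
  have fin: "finite (f ` ?K)" using finite_int_vec_bounded by blast
  have z: "0 \<in> ?K" using \<open>r \<ge> 0\<close> by (simp add: real_vec_def zero_vec_def[symmetric])
  then obtain k where k: "k \<in> ?K" "f k = Max (f ` ?K)"
    using Max_in[OF fin] by (metis (no_types, lifting) empty_iff image_iff)
  have max: "f k' \<le> f k" for k'
  proof (cases "k' \<in> ?K")
    case True
    then show ?thesis using k(2) Max_ge[OF fin] by auto
  next
    case False
    then have "f k' \<le> f 0" using neg f0 by auto
    also have "f 0 \<le> f k" using k(2) Max_ge[OF fin] z by auto
    finally show ?thesis .
  qed
  have "Theta Q x = f k"
    unfolding Theta_def f_def[symmetric] by (rule cSup_eq_maximum) (auto intro: max)
  with max show thesis
    using that[of k] by (simp add: f_def)
qed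

lemma Theta_int_mod2_le:
  assumes "Q \<in> H4_trop"
  shows "Theta_int u Q \<le> Theta_int (u + 2 *s w) Q"
proof -
  let ?q = "\<lambda>x y. x \<bullet> (Q *v y)"
  let ?a = "real_vec u" and ?d = "real_vec w"
  have sym: "?q x y = ?q y x" for x y
    using assms dot_lmul_matrix[of x Q y] vector_transpose_matrix[of x Q]
    by (simp add: H4_trop_def inner_commute)
  have add: "real_vec (x + y) = real_vec x + real_vec y" for x y :: "int ^ 4"
    by (simp add: real_vec_def vec_eq_iff)
  have dbl: "real_vec (2 *s w) = ?d + ?d"
    by (simp add: real_vec_def vec_eq_iff)
  obtain k where k: "Theta Q ((1/2) *\<^sub>R ?a) =
      ?q (real_vec k) ((1/2) *\<^sub>R ?a) - 1/2 * ?q (real_vec k) (real_vec k)"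
    using Theta_attained[OF assms] by blast
  let ?b = "real_vec k"
  have "?q (real_vec (k + w)) ((1/2) *\<^sub>R real_vec (u + 2 *s w))
      - 1/2 * ?q (real_vec (k + w)) (real_vec (k + w)) \<le> Theta Q ((1/2) *\<^sub>R real_vec (u + 2 *s w))"
    using Theta_attained[OF assms] by blast
  moreover have "(1/2) *\<^sub>R real_vec (u + 2 *s w) = (1/2) *\<^sub>R ?a + ?d"
    unfolding add dbl by (simp add: vec_eq_iff)
  ultimately show ?thesis
    unfolding Theta_int_def k add dbl
    by (simp only: matrix_vector_right_distrib matrix_vector_mult_scaleR inner_add_left
        inner_add_right inner_scaleR_right sym[of ?d ?a] sym[of ?d ?b] sym[of ?b ?a]) argo
qed

lemma Theta_int_mod2:
  assumes "Q \<in> H4_trop"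
  shows "Theta_int (u + 2 *s w) Q = Theta_int u Q"
proof (rule antisym)
  have "u + 2 *s w + 2 *s (- w) = u" by (simp add: vec_eq_iff)
  then show "Theta_int (u + 2 *s w) Q \<le> Theta_int u Q"
    using Theta_int_mod2_le[OF assms, of "u + 2 *s w" "- w"] by simp
qed (rule Theta_int_mod2_le[OF assms])

lemma Theta_mod2_eq:
  assumes "Q \<in> H4_trop" "\<And>i. of_int (u $ i) = v $ i"
  shows "Theta_mod2 v Q = Theta_int u Q"
proof -
  have of_int_bit: "(of_int n :: bit) = of_bool (odd n)" for n
    by (cases "even n") (auto elim!: evenE oddE)
  have "even (u $ i - lift_int v $ i)" for i
    by (simp add: lift_int_def of_int_bit flip: assms(2))
  then have "u = lift_int v + 2 *s (\<chi> i. (u $ i - lift_int v $ i) div 2)"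
    by (simp add: vec_eq_iff)
  then show ?thesis
    using Theta_int_mod2[OF assms(1)] by (metis Theta_mod2_def)
qed

end

theory Submission
  imports Defs
begin

text \<open>
  Completing the square, \<open>\<Theta>\<^sub>u(Q)\<close> is \<open>-1/4\<close> times the minimum of \<open>w\<^sup>t Q w\<close> over all integer vectors
  \<open>w\<close> congruent to \<open>u\<close> modulo 2. Three facts make up the theorem.

  The characterization. For an admissible choice, \<open>N'\<close> is a hyperplane \<open>v\<^sup>\<bottom>\<close>, so each \<open>\<pi>\<^sub>i\<close> is the sum
  of \<open>\<Theta>\<^sub>u\<close> either over \<open>v\<^sup>\<bottom>\<close> or over its complement, and these two sums differ by \<open>\<vartheta>\<^sub>v\<close>. The parity
  conditions force exactly one of the three characteristics to give the complement
  (\<open>admissible_structure\<close>), so the maximum is attained twice if and only if the other two win or tie,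
  that is, \<open>\<vartheta>\<^sub>v(Q) \<ge> 0\<close>. Every nonzero \<open>v\<close> occurs (\<open>ex_admissible\<close>).

  The inclusion. If \<open>Q = \<Sum>\<^sub>e l\<^sub>e b\<^sub>e b\<^sub>e\<^sup>t\<close> comes from a metric graph, then \<open>w\<^sup>t Q w\<close> is the squared length of
  the cycle with coordinates \<open>w\<close>. In each class modulo 2 the minimum is attained at an
  Eulerian subgraph with an orientation, whose entries are \<open>0\<close> and \<open>\<plusminus>1\<close> (\<open>eulerian_orientation\<close>). So
  \<open>\<Theta>\<^sub>u\<close> is \<open>-1/4\<close> times the total length of the edges with \<open>u \<bullet> b\<^sub>e\<close> odd, and by orthogonality of
  characters \<open>\<vartheta>\<^sub>v\<close> is twice the total length of the edges whose vector \<open>b\<^sub>e\<close> reduces to \<open>v\<close> modulo 2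
  (\<open>dicing.vartheta_Q\<close>).

  The strictness. This computation applies to every system of vectors \<open>b\<^sub>e\<close> of the same unimodular
  kind, in particular to the graphic matroid of the complete graph on five vertices. There ten of
  the \<open>\<vartheta>\<^sub>v\<close> are positive. For a graph of genus 4 at most \<open>3 \<cdot> 4 - 3 = 9\<close> can be, as in the bound for
  the number of edges of a stable graph (\<open>card_edge_classes_le\<close>).
\<close>

section \<open>Vectors over the two-element field\<close>

definition bit_sign :: "bit \<Rightarrow> real" where
  "bit_sign b = (-1) ^ of_bit b"

lemma bit_sign_simps [simp]: "bit_sign 0 = 1" "bit_sign 1 = -1"
  by (simp_all add: bit_sign_def)

lemma bit_sign_add: "bit_sign (a + b) = bit_sign a * bit_sign b"
  by (cases a; cases b) simp_all

lemma bit_vec_add_eq_0_iff: "(u :: bit ^ 'n) + v = 0 \<longleftrightarrow> u = v"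
proof -
  have "(a::bit) + b = 0 \<longleftrightarrow> a = b" for a b by (cases a; cases b) simp_all
  then show ?thesis by (simp add: vec_eq_iff)
qed

lemma bit_vec_add_self [simp]: "(u :: bit ^ 'n) + u = 0"
  by (simp only: bit_vec_add_eq_0_iff)

lemma dot2_add_left: "dot2 (u + u') v = dot2 u v + dot2 u' v"
  by (simp add: dot2_def distrib_right sum.distrib del: add_bit_eq_xor mult_bit_eq_and)

lemma dot2_add_right: "dot2 u (v + v') = dot2 u v + dot2 u v'"
  by (simp add: dot2_def distrib_left sum.distrib del: add_bit_eq_xor mult_bit_eq_and)

lemma dot2_commute: "dot2 u v = dot2 v u"
  by (simp add: dot2_def mult.commute del: mult_bit_eq_and)

lemma dot2_0 [simp]: "dot2 0 v = 0" "dot2 u 0 = 0"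
  by (simp_all add: dot2_def)

lemma dot2_axis: "dot2 u (axis i 1) = u $ i"
proof -
  have "dot2 u (axis i 1) = (\<Sum>j\<in>UNIV. if j = i then u $ j else 0)"
    unfolding dot2_def by (rule sum.cong) (auto simp: axis_def)
  then show ?thesis by simp
qed

lemma ex_dot2_eq_1:
  assumes "v \<noteq> (0 :: bit ^ 'n)"
  obtains p where "dot2 p v = 1"
proof -
  obtain i where "v $ i \<noteq> 0" using assms by (auto simp: vec_eq_iff)
  then have "dot2 (axis i 1) v = 1" by (simp add: dot2_commute[of _ v] dot2_axis)
  then show thesis by (rule that)
qed

lemma CARD_bit: "CARD(bit) = 2"
proof -
  have "(UNIV :: bit set) = {0, 1}" using bit_not_zero_iff by blast
  then have "CARD(bit) = card {0 :: bit, 1}" by (rule arg_cong)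
  then show ?thesis by simp
qed

lemma finite_bit_vec [simp]: "finite (A :: (bit ^ 'n) set)"
proof -
  have "CARD(bit ^ 'n) \<noteq> 0" by (simp add: CARD_bit)
  then show ?thesis by (metis card.infinite finite_subset top_greatest)
qed

text \<open>
  Orthogonality of the characters of \<open>(\<int>/2)\<^sup>4\<close>: a translation by some \<open>p\<close> that does not
  annihilate \<open>v\<close> flips the sign of every summand.
\<close>

lemma sum_bit_sign_dot2:
  fixes v :: "bit ^ 4"
  shows "(\<Sum>u\<in>UNIV. bit_sign (dot2 u v)) = (if v = 0 then 16 else 0)"
proof (cases "v = 0")
  case True
  then show ?thesis by (simp add: CARD_bit)
next
  case False
  then obtain p where p: "dot2 p v = 1" by (rule ex_dot2_eq_1)
  have "(\<Sum>u\<in>UNIV. bit_sign (dot2 u v)) = (\<Sum>u\<in>UNIV. bit_sign (dot2 (p + u) v))"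
    by (rule sum.reindex_bij_witness[of _ "\<lambda>u. p + u" "\<lambda>u. p + u"])
       (simp_all flip: add.assoc)
  also have "\<dots> = - (\<Sum>u\<in>UNIV. bit_sign (dot2 u v))"
    by (simp add: dot2_add_left bit_sign_add p sum_negf del: add_bit_eq_xor)
  finally show ?thesis using False by simp
qed

section \<open>Theta constants of unimodular sums of squares\<close>

definition idot :: "int ^ 'n \<Rightarrow> int ^ 'n \<Rightarrow> int" where
  "idot w b = (\<Sum>i\<in>UNIV. w $ i * b $ i)"

definition mod2 :: "int ^ 'n \<Rightarrow> bit ^ 'n" where
  "mod2 b = (\<chi> i. of_int (b $ i))"

lemma of_int_bit: "(of_int n :: bit) = of_bool (odd n)"
  by (cases "even n") (auto elim!: evenE oddE)

lemma of_int_of_bit [simp]: "of_int (of_bit x) = (x :: bit)"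
  by (cases x) simp_all

lemma dot2_mod2: "dot2 (mod2 w) (mod2 b) = of_int (idot w b)"
  by (simp add: dot2_def mod2_def idot_def del: mult_bit_eq_and)

lemma inner_real_vec: "real_vec w \<bullet> real_vec b = of_int (idot w b)"
  by (simp add: inner_vec_def real_vec_def idot_def)

text \<open>
  The Gram matrix of the quadratic form \<open>x \<mapsto> \<Sum>\<^sub>e l\<^sub>e (x \<bullet> b\<^sub>e)\<^sup>2\<close>. Both the matrices of metric graphs
  and the matrix that separates the two loci have this shape.
\<close>

definition rank_one_sum :: "'e set \<Rightarrow> ('e \<Rightarrow> real) \<Rightarrow> ('e \<Rightarrow> int ^ 'n) \<Rightarrow> real ^ 'n ^ 'n" where
  "rank_one_sum E l b = (\<chi> i j. \<Sum>e\<in>E. of_int (b e $ i) * l e * of_int (b e $ j))"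

lemma inner_rank_one_sum:
  "x \<bullet> (rank_one_sum E l b *v y) = (\<Sum>e\<in>E. l e * (x \<bullet> real_vec (b e)) * (y \<bullet> real_vec (b e)))"
proof -
  have "x \<bullet> (rank_one_sum E l b *v y) =
    (\<Sum>i\<in>UNIV. \<Sum>j\<in>UNIV. \<Sum>e\<in>E. l e * (x $ i * of_int (b e $ i)) * (y $ j * of_int (b e $ j)))"
    by (simp add: inner_vec_def matrix_vector_mult_def rank_one_sum_def sum_distrib_left
        sum_distrib_right mult_ac)
  also have "\<dots> = (\<Sum>e\<in>E. \<Sum>i\<in>UNIV. \<Sum>j\<in>UNIV.
      l e * (x $ i * of_int (b e $ i)) * (y $ j * of_int (b e $ j)))"
    by (simp only: sum.swap[of _ E])
  also have "\<dots> = (\<Sum>e\<in>E. l e * (x \<bullet> real_vec (b e)) * (y \<bullet> real_vec (b e)))"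
    by (simp add: inner_vec_def real_vec_def mult.assoc sum_product)
       (simp add: sum_distrib_left mult.assoc)
  finally show ?thesis .
qed

text \<open>
  The condition \<open>small_lift\<close> is a consequence of total unimodularity of the vectors \<open>b\<^sub>e\<close>, and it is
  the form in which unimodularity enters: on the representative \<open>w\<close> every linear form \<open>b\<^sub>e\<close> takes the
  smallest absolute value that its parity permits, so \<open>w\<close> minimizes all the squares \<open>(w \<bullet> b\<^sub>e)\<^sup>2\<close> in its class simultaneously.
\<close>

locale dicing =
  fixes E :: "'e set" and l :: "'e \<Rightarrow> real" and b :: "'e \<Rightarrow> int ^ 4"
  assumes finite_E: "finite E"
    and l_pos: "e \<in> E \<Longrightarrow> l e > 0"
    and spanning: "\<forall>e\<in>E. x \<bullet> real_vec (b e) = 0 \<Longrightarrow> x = 0"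
    and small_lift: "\<exists>w. mod2 w = u \<and> (\<forall>e\<in>E. \<bar>idot w (b e)\<bar> \<le> 1)"
begin

abbreviation Q where "Q \<equiv> rank_one_sum E l b"

lemma Q_in_H4_trop: "Q \<in> H4_trop"
proof -
  have "x \<bullet> (Q *v x) > 0" if "x \<noteq> 0" for x
  proof -
    obtain e where e: "e \<in> E" "x \<bullet> real_vec (b e) \<noteq> 0"
      using spanning[of x] \<open>x \<noteq> 0\<close> by blast
    have "(\<Sum>e\<in>E. l e * (x \<bullet> real_vec (b e))\<^sup>2) > 0"
    proof (rule sum_pos2[OF finite_E e(1)])
      show "0 < l e * (x \<bullet> real_vec (b e))\<^sup>2" using e l_pos by simp
      show "\<And>f. f \<in> E \<Longrightarrow> 0 \<le> l f * (x \<bullet> real_vec (b f))\<^sup>2" using l_pos by (simp add: less_imp_le)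
    qed
    then show ?thesis by (simp add: inner_rank_one_sum power2_eq_square mult.assoc)
  qed
  then show ?thesis
    by (auto simp: H4_trop_def transpose_def rank_one_sum_def vec_eq_iff mult_ac)
qed

text \<open>
  Evaluate at the small representative \<open>w\<close> of the class \<open>u\<close>. The objective function of
  \<open>\<Theta>(Q, w/2)\<close> at \<open>k\<close> is \<open>-1/2 \<Sum>\<^sub>e l\<^sub>e (k \<bullet> b\<^sub>e) (k \<bullet> b\<^sub>e - w \<bullet> b\<^sub>e)\<close>, and no summand is negative because
  \<open>\<bar>w \<bullet> b\<^sub>e\<bar> \<le> 1\<close>. So the maximum is 0, attained at \<open>k = 0\<close>, and only \<open>-1/4 w\<^sup>t Q w\<close> survives.
  There \<open>(w \<bullet> b\<^sub>e)\<^sup>2\<close> is 1 or 0 according to the parity of \<open>u \<bullet> b\<^sub>e\<close>.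
\<close>

lemma Theta_mod2_Q:
  "Theta_mod2 u Q = - (1/8) * (\<Sum>e\<in>E. l e * (1 - bit_sign (dot2 u (mod2 (b e)))))"
proof -
  obtain w where w: "mod2 w = u" "\<And>e. e \<in> E \<Longrightarrow> \<bar>idot w (b e)\<bar> \<le> 1"
    using small_lift by blast
  \<comment> \<open>The origin is a maximizer in the definition of \<open>\<Theta>(Q, w/2)\<close>.\<close>
  have "real_vec k \<bullet> (Q *v ((1/2) *\<^sub>R real_vec w)) - 1/2 * (real_vec k \<bullet> (Q *v real_vec k)) \<le> 0" for k
  proof -
    have "l e * of_int (idot k (b e)) * of_int (idot w (b e))
        \<le> l e * (of_int (idot k (b e)) * of_int (idot k (b e)))" if "e \<in> E" for e
    proof -
      have nn: "n * m \<le> n * n" if "\<bar>m\<bar> \<le> 1" for n m :: int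
      proof (cases "n = 0")
        case False
        then have "\<bar>n\<bar> * \<bar>m\<bar> \<le> \<bar>n\<bar> * \<bar>n\<bar>" using that by (intro mult_left_mono) auto
        then show ?thesis by (metis abs_ge_self abs_mult abs_mult_self_eq order_trans)
      qed simp
      have "real_of_int (idot k (b e)) * of_int (idot w (b e)) \<le> of_int (idot k (b e)) * of_int (idot k (b e))"
        using nn[OF w(2)[OF that], of "idot k (b e)"] by (simp flip: of_int_mult)
      then show ?thesis using l_pos[OF that] by (simp add: mult.assoc)
    qed
    then show ?thesis
      by (simp add: inner_rank_one_sum inner_real_vec sum_divide_distrib[symmetric]
          mult.assoc sum_mono)
  qed
  moreover have "real_vec 0 = (0 :: real ^ 4)" by (simp add: real_vec_def vec_eq_iff)
  ultimately have "Theta Q ((1/2) *\<^sub>R real_vec w) = 0"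
    unfolding Theta_def by (intro cSup_eq_maximum) (auto intro!: image_eqI[of _ _ 0])
  then have "Theta_mod2 u Q = - (1/4) * (\<Sum>e\<in>E. l e * (of_int (idot w (b e)))\<^sup>2)"
    using Theta_mod2_eq[OF Q_in_H4_trop, of w u] w(1)
    by (simp add: mod2_def vec_eq_iff Theta_int_def inner_rank_one_sum inner_real_vec
        power2_eq_square mult.assoc)
  also have "(\<Sum>e\<in>E. l e * (of_int (idot w (b e)))\<^sup>2)
      = (\<Sum>e\<in>E. l e * (1 - bit_sign (dot2 u (mod2 (b e))))) / 2"
    unfolding sum_divide_distrib
  proof (rule sum.cong[OF refl])
    fix e assume "e \<in> E"
    then have "idot w (b e) \<in> {-1, 0, 1}" using w(2)[of e] by auto
    then have "(of_int (idot w (b e)))\<^sup>2 = (1 - bit_sign (of_int (idot w (b e)))) / 2"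
      by (auto simp: of_int_bit)
    then show "l e * (of_int (idot w (b e)))\<^sup>2 = l e * (1 - bit_sign (dot2 u (mod2 (b e)))) / 2"
      by (simp add: w(1)[symmetric] dot2_mod2)
  qed
  finally show ?thesis by simp
qed

text \<open>
  Summing the previous formula against the character of \<open>v\<close>, orthogonality kills every edge
  except those whose class is \<open>v\<close>. So the theta constants recover the total length of each class.
\<close>

theorem vartheta_Q:
  assumes "v \<noteq> 0"
  shows "vartheta v Q = 2 * (\<Sum>e\<in>{e\<in>E. mod2 (b e) = v}. l e)"
proof -
  have "vartheta v Q = (\<Sum>u\<in>UNIV. bit_sign (dot2 u v) *
      (- (1/8) * (\<Sum>e\<in>E. l e * (1 - bit_sign (dot2 u (mod2 (b e)))))))"
    by (simp add: vartheta_def Theta_mod2_Q bit_sign_def)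
  also have "\<dots> = (\<Sum>u\<in>UNIV. \<Sum>e\<in>E. - (1/8) * l e *
      (bit_sign (dot2 u v) - bit_sign (dot2 u (v + mod2 (b e)))))"
    by (simp add: dot2_add_right bit_sign_add sum_distrib_left algebra_simps del: add_bit_eq_xor)
  also have "\<dots> = (\<Sum>e\<in>E. - (1/8) * l e * (\<Sum>u\<in>UNIV.
      bit_sign (dot2 u v) - bit_sign (dot2 u (v + mod2 (b e)))))"
    by (subst sum.swap) (simp add: sum_distrib_left)
  also have "\<dots> = (\<Sum>e\<in>E. 2 * (if mod2 (b e) = v then l e else 0))"
    using assms by (intro sum.cong refl)
      (auto simp: sum_subtractf sum_bit_sign_dot2 bit_vec_add_eq_0_iff)
  also have "\<dots> = 2 * (\<Sum>e\<in>{e\<in>E. mod2 (b e) = v}. l e)"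
    using finite_E by (simp add: sum.inter_filter sum_distrib_left)
  finally show ?thesis .
qed

end


section \<open>Integral circulations\<close>

definition net_inflow ::
  "('e \<Rightarrow> 'v) \<Rightarrow> ('e \<Rightarrow> 'v) \<Rightarrow> 'e set \<Rightarrow> ('e \<Rightarrow> int) \<Rightarrow> 'v \<Rightarrow> int" where
  "net_inflow t h A w v = (\<Sum>e\<in>A. w e * (of_bool (h e = v) - of_bool (t e = v)))"

text \<open>
  Add up the conservation laws over the vertices in \<open>K\<close>: edges inside \<open>K\<close> cancel.
\<close>

lemma circulation_across_cut:
  assumes "finite A" and "\<And>v. v \<in> K \<Longrightarrow> net_inflow t h A w v = 0"
  shows "(\<Sum>e\<in>A. w e * (of_bool (h e \<in> K) - of_bool (t e \<in> K))) = 0"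
proof -
  define V where "V = (h ` A \<union> t ` A) \<inter> K"
  have fin: "finite V" using assms(1) by (simp add: V_def)
  have "(\<Sum>e\<in>A. w e * (of_bool (h e \<in> K) - of_bool (t e \<in> K)))
      = (\<Sum>e\<in>A. \<Sum>v\<in>V. w e * (of_bool (h e = v) - of_bool (t e = v)))"
  proof (rule sum.cong[OF refl])
    fix e assume e: "e \<in> A"
    have "of_bool (x \<in> K) = (\<Sum>v\<in>V. of_bool (x = v) :: int)" if "x \<in> {h e, t e}" for x
      using that e fin by (auto simp: of_bool_def V_def)
    then show "w e * (of_bool (h e \<in> K) - of_bool (t e \<in> K))
        = (\<Sum>v\<in>V. w e * (of_bool (h e = v) - of_bool (t e = v)))"
      by (simp add: sum_distrib_left sum_subtractf right_diff_distrib)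
  qed
  also have "\<dots> = (\<Sum>v\<in>V. net_inflow t h A w v)"
    unfolding net_inflow_def by (rule sum.swap)
  also have "\<dots> = 0" using assms(2) by (simp add: V_def)
  finally show ?thesis .
qed

text \<open>
  The edges of a shortest path carry a unit flow. Choosing the path shortest guarantees that no
  edge is used twice: each new edge ends at a vertex farther from \<open>a\<close> than all earlier heads.
\<close>

lemma shortest_path_flow:
  fixes t h :: "'e \<Rightarrow> 'v"
  assumes "finite A" "(a, b) \<in> {(t e, h e) |e. e \<in> A}\<^sup>*"
  obtains P where "P \<subseteq> A"
    "\<And>v. net_inflow t h P (\<lambda>_. 1) v = of_bool (v = b) - of_bool (v = a)"
proof -
  let ?R = "{(t e, h e) |e. e \<in> A}"
  have "\<exists>P\<subseteq>A. (\<forall>e\<in>P. \<exists>m\<le>n. (a, h e) \<in> ?R ^^ m) \<and>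
      (\<forall>v. net_inflow t h P (\<lambda>_. 1) v = of_bool (v = b) - of_bool (v = a))"
    if "(a, b) \<in> ?R ^^ n" "\<And>m. m < n \<Longrightarrow> (a, b) \<notin> ?R ^^ m" for n b
    using that
  proof (induction n arbitrary: b)
    case 0
    then show ?case by (intro exI[of _ "{}"]) (auto simp: net_inflow_def)
  next
    case (Suc n)
    then obtain e where e: "e \<in> A" "h e = b" and c: "(a, t e) \<in> ?R ^^ n" by auto
    have "(a, t e) \<notin> ?R ^^ m" if "m < n" for m
    proof
      assume "(a, t e) \<in> ?R ^^ m"
      then have "(a, b) \<in> ?R ^^ Suc m" using e by auto
      then show False using Suc.prems(2)[of "Suc m"] that by simp
    qed
    with Suc.IH[OF c] obtain P where P: "P \<subseteq> A" "\<forall>e\<in>P. \<exists>m\<le>n. (a, h e) \<in> ?R ^^ m"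
      "\<And>v. net_inflow t h P (\<lambda>_. 1) v = of_bool (v = t e) - of_bool (v = a)"
      by blast
    \<comment> \<open>Heads of edges in \<open>P\<close> are closer to \<open>a\<close> than \<open>b\<close> is.\<close>
    have "e \<notin> P"
    proof
      assume "e \<in> P"
      then obtain m where "m \<le> n" "(a, b) \<in> ?R ^^ m" using P(2) e(2) by blast
      then show False using Suc.prems(2)[of m] by simp
    qed
    moreover have "finite P" using P(1) assms(1) by (rule finite_subset)
    ultimately have "net_inflow t h (insert e P) (\<lambda>_. 1) v = of_bool (v = b) - of_bool (v = a)" for v
      using P(3)[of v] e(2) by (auto simp: net_inflow_def)
    moreover have "\<forall>f\<in>insert e P. \<exists>m\<le>Suc n. (a, h f) \<in> ?R ^^ m"
      using P(2) Suc.prems(1) e(2) le_Suc_eq by blast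
    ultimately show ?case using P(1) e(1) by (intro exI[of _ "insert e P"]) auto
  qed
  moreover obtain n where "(a, b) \<in> ?R ^^ n" "\<And>m. m < n \<Longrightarrow> (a, b) \<notin> ?R ^^ m"
    using assms(2) exists_least_iff[of "\<lambda>n. (a, b) \<in> ?R ^^ n"] by (auto simp: rtrancl_is_UN_relpow)
  ultimately show thesis using that by blast
qed

text \<open>
  If the tail of \<open>e\<^sub>0\<close> could not be reached from its head, then the set \<open>K\<close> of reachable vertices
  would receive the flow through \<open>e\<^sub>0\<close> and lose nothing. A path from the head back to the tail that
  avoids \<open>e\<^sub>0\<close> closes up with \<open>e\<^sub>0\<close> to the desired cycle.
\<close>

lemma directed_cycle_through_edge:
  fixes t h :: "'e \<Rightarrow> 'v"
  assumes "finite A" "\<And>e. e \<in> A \<Longrightarrow> w e > 0" "\<And>v. net_inflow t h A w v = 0" "e\<^sub>0 \<in> A"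
  obtains P where "P \<subseteq> A" "e\<^sub>0 \<in> P" "\<And>v. net_inflow t h P (\<lambda>_. 1) v = 0"
proof -
  define R where "R = {(t e, h e) |e. e \<in> A - {e\<^sub>0}}"
  define K where "K = {v. (h e\<^sub>0, v) \<in> R\<^sup>*}"
  have "t e\<^sub>0 \<in> K"
  proof (rule ccontr)
    assume K: "t e\<^sub>0 \<notin> K"
    have "h e \<in> K" if "e \<in> A" "t e \<in> K" for e
    proof -
      have "(t e, h e) \<in> R" using that K by (auto simp: R_def)
      then show ?thesis using that(2) by (auto simp: K_def intro: rtrancl_into_rtrancl)
    qed
    then have "w e * (of_bool (h e \<in> K) - of_bool (t e \<in> K)) \<ge> 0" if "e \<in> A" for e
      using assms(2)[OF that] that by auto
    moreover have "h e\<^sub>0 \<in> K" by (simp add: K_def)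
    ultimately have "(\<Sum>e\<in>A. w e * (of_bool (h e \<in> K) - of_bool (t e \<in> K))) > 0"
      using assms(1,2,4) K by (intro sum_pos2[of A e\<^sub>0]) auto
    then show False using circulation_across_cut[OF assms(1,3)] by simp
  qed
  then obtain P where P: "P \<subseteq> A - {e\<^sub>0}"
    "\<And>v. net_inflow t h P (\<lambda>_. 1) v = of_bool (v = t e\<^sub>0) - of_bool (v = h e\<^sub>0)"
    using shortest_path_flow[of "A - {e\<^sub>0}" "h e\<^sub>0" "t e\<^sub>0" t h] assms(1)
    by (auto simp: K_def R_def)
  have "finite P" "e\<^sub>0 \<notin> P" using P(1) assms(1) by (auto intro: finite_subset)
  then have "net_inflow t h (insert e\<^sub>0 P) (\<lambda>_. 1) v = 0" for v
    using P(2)[of v] by (auto simp: net_inflow_def)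
  then show thesis using P(1) assms(4) by (intro that[of "insert e\<^sub>0 P"]) auto
qed

lemma H1_iff:
  assumes "fin_digraph G"
  shows "c \<in> H1 G \<longleftrightarrow>
    (\<forall>e. e \<notin> arcs G \<longrightarrow> c e = 0) \<and> (\<forall>v. net_inflow (tail G) (head G) (arcs G) c v = 0)"
proof -
  interpret fin_digraph G by fact
  have "net_inflow (tail G) (head G) (arcs G) c v
      = (\<Sum>e\<in>in_arcs G v. c e) - (\<Sum>e\<in>out_arcs G v. c e)" for v
    by (simp add: net_inflow_def right_diff_distrib sum_subtractf in_arcs_def out_arcs_def
        Int_def)
  moreover have "in_arcs G v = {}" "out_arcs G v = {}" if "v \<notin> verts G" for v
    using that by auto
  ultimately show ?thesis
    by (auto simp: H1_def)
qed

lemma H1_combine: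
  assumes "fin_digraph G" "c \<in> H1 G" "d \<in> H1 G"
  shows "(\<lambda>e. p * c e + q * d e) \<in> H1 G"
proof -
  have "net_inflow (tail G) (head G) (arcs G) (\<lambda>e. p * c e + q * d e) v
     = p * net_inflow (tail G) (head G) (arcs G) c v + q * net_inflow (tail G) (head G) (arcs G) d v" for v
    by (simp add: net_inflow_def distrib_right sum.distrib sum_distrib_left mult.assoc)
  then show ?thesis using assms by (simp add: H1_iff)
qed

lemma H1_sum:
  assumes "fin_digraph G" "finite I" "\<And>i. i \<in> I \<Longrightarrow> B i \<in> H1 G"
  shows "(\<lambda>e. \<Sum>i\<in>I. a i * B i e) \<in> H1 G"
  using assms(2,3)
proof (induction rule: finite_induct)
  case empty
  then show ?case using assms(1) by (simp add: H1_iff net_inflow_def)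
next
  case (insert i I)
  then show ?case
    using H1_combine[OF assms(1), of "B i" "\<lambda>e. \<Sum>i\<in>I. a i * B i e" "a i" 1] by simp
qed

text \<open>
  The edges on which an integral cycle is odd form an Eulerian subgraph, and an Eulerian subgraph
  can be oriented to a cycle. The descent avoids Euler tours: as long as some
  \<open>\<bar>y e\<^sub>0\<bar>\<close> exceeds 1, take a directed cycle through \<open>e\<^sub>0\<close> along the direction of flow of \<open>y\<close> and
  subtract it twice. An edge of value \<open>\<plusminus>1\<close> then changes its sign, and larger values become smaller.
\<close>

lemma eulerian_orientation:
  assumes G: "fin_digraph G" and "y \<in> H1 G"
  shows "\<exists>z\<in>H1 G. \<forall>e. \<bar>z e\<bar> \<le> 1 \<and> even (z e - y e)"
  using \<open>y \<in> H1 G\<close>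
proof (induction "\<Sum>e\<in>arcs G. nat \<bar>y e\<bar>" arbitrary: y rule: less_induct)
  case less
  interpret fin_digraph G by fact
  show ?case
  proof (cases "\<forall>e. \<bar>y e\<bar> \<le> 1")
    case True
    then show ?thesis using less.prems by auto
  next
    case False
    then obtain e\<^sub>0 where e0: "\<bar>y e\<^sub>0\<bar> > 1" by (auto simp: not_le)
    define A where "A = {e \<in> arcs G. y e \<noteq> 0}"
    \<comment> \<open>\<open>t\<close> and \<open>h\<close> reorient every edge so that \<open>y\<close> becomes the positive flow \<open>\<bar>y\<bar>\<close>.\<close>
    define t where "t e = (if y e > 0 then tail G e else head G e)" for e
    define h where "h e = (if y e > 0 then head G e else tail G e)" for e
    have fin: "finite A" by (simp add: A_def)
    have y: "y e = 0" if "e \<notin> arcs G" for e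
      using less.prems that G by (simp add: H1_iff)
    have "net_inflow t h A (\<lambda>e. \<bar>y e\<bar>) v = net_inflow (tail G) (head G) (arcs G) y v" for v
      unfolding net_inflow_def by (rule sum.mono_neutral_cong_left) (auto simp: A_def t_def h_def)
    then have "net_inflow t h A (\<lambda>e. \<bar>y e\<bar>) v = 0" for v
      using less.prems G by (simp add: H1_iff)
    moreover have "e\<^sub>0 \<in> A" using e0 y[of e\<^sub>0] by (force simp: A_def)
    moreover have "\<bar>y e\<bar> > 0" if "e \<in> A" for e using that by (simp add: A_def)
    ultimately obtain P where P: "P \<subseteq> A" "e\<^sub>0 \<in> P" "\<And>v. net_inflow t h P (\<lambda>_. 1) v = 0"
      using directed_cycle_through_edge[OF fin, of "\<lambda>e. \<bar>y e\<bar>" t h e\<^sub>0] by metis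
    define c where "c e = (if e \<in> P then sgn (y e) else 0)" for e
    have "net_inflow (tail G) (head G) (arcs G) c v = net_inflow t h P (\<lambda>_. 1) v" for v
      unfolding net_inflow_def
      by (rule sum.mono_neutral_cong_right) (use P(1) in \<open>auto simp: A_def c_def t_def h_def sgn_if\<close>)
    then have c: "c \<in> H1 G"
      using P G by (auto simp: H1_iff c_def A_def)
    define y' where "y' e = y e - 2 * c e" for e
    have "y' \<in> H1 G"
      using H1_combine[OF G less.prems c, of 1 "-2"] by (simp add: y'_def[abs_def])
    moreover have "(\<Sum>e\<in>arcs G. nat \<bar>y' e\<bar>) < (\<Sum>e\<in>arcs G. nat \<bar>y e\<bar>)"
    proof (rule sum_strict_mono_ex1)
      show "\<forall>e\<in>arcs G. nat \<bar>y' e\<bar> \<le> nat \<bar>y e\<bar>"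
        using P(1) by (auto simp: y'_def c_def A_def sgn_if)
      show "\<exists>e\<in>arcs G. nat \<bar>y' e\<bar> < nat \<bar>y e\<bar>"
        using P(1,2) e0 by (intro bexI[of _ e\<^sub>0]) (auto simp: y'_def c_def A_def sgn_if)
    qed simp
    ultimately obtain z where z: "z \<in> H1 G" "\<forall>e. \<bar>z e\<bar> \<le> 1 \<and> even (z e - y' e)"
      using less.hyps by blast
    then have "\<forall>e. even (z e - y e)" by (auto simp: y'_def)
    with z show ?thesis by blast
  qed
qed


section \<open>Matrices of metric graphs\<close>

text \<open>
  Integer vectors with a real linear relation have an integral one. Scale the relation to have an
  entry 1 and approximate it simultaneously by fractions \<open>k\<^sub>i/q\<close>. The integer
  \<open>k \<bullet> b\<^sub>e\<close> has absolute value below 1 when the approximation is good enough, so it vanishes, and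
  \<open>k\<close> is not zero because its entry at the scaled coordinate is \<open>q\<close>.
\<close>

lemma integral_relation_of_real_relation:
  fixes b :: "'e \<Rightarrow> int ^ 'n" and x :: "real ^ 'n"
  assumes "finite E" "x \<noteq> 0" and rel: "\<And>e. e \<in> E \<Longrightarrow> x \<bullet> real_vec (b e) = 0"
  obtains k where "k \<noteq> 0" "\<And>e. e \<in> E \<Longrightarrow> idot k (b e) = 0"
proof -
  obtain j where j: "x $ j \<noteq> 0" using assms(2) by (auto simp: vec_eq_iff)
  obtain f where f: "bij_betw f (UNIV :: 'n set) {..<CARD('n)}"
    by (metis finite_class.finite_UNIV ex_bij_betw_finite_nat lessThan_atLeast0)
  define \<theta> where "\<theta> i = x $ i / x $ j" for i
  define N where "N = nat (\<Sum>e\<in>E. \<Sum>i\<in>UNIV. \<bar>b e $ i\<bar>) + 1"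
  have "N > 0" by (simp add: N_def)
  then obtain q p where q: "0 < q" and
    p: "\<And>i. i < CARD('n) \<Longrightarrow> \<bar>of_int q * \<theta> (inv f i) - of_int (p i)\<bar> < 1 / N"
    using Dirichlet_approx_simult[of N "CARD('n)" "\<lambda>i. \<theta> (inv f i)"] by metis
  define k where "k = (\<chi> i. p (f i))"
  have k: "\<bar>of_int q * \<theta> i - of_int (k $ i)\<bar> < 1 / N" for i
    using p[of "f i"] f by (simp add: k_def bij_betw_def inj_on_def inv_f_f) (metis UNIV_I imageI lessThan_iff)
  have "k $ j \<noteq> 0"
  proof
    assume "k $ j = 0"
    then have "\<bar>real_of_int q\<bar> < 1 / N" using k[of j] j by (simp add: \<theta>_def)
    also have "\<dots> \<le> 1" by (simp add: N_def)
    finally show False using q by simp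
  qed
  then have "k \<noteq> 0" by auto
  moreover have "idot k (b e) = 0" if "e \<in> E" for e
  proof -
    have "(\<Sum>i\<in>UNIV. \<theta> i * of_int (b e $ i)) = (x \<bullet> real_vec (b e)) / x $ j"
      by (simp add: \<theta>_def inner_vec_def real_vec_def sum_divide_distrib)
    then have "(\<Sum>i\<in>UNIV. \<theta> i * of_int (b e $ i)) = 0" using rel[OF that] by simp
    then have "(\<Sum>i\<in>UNIV. of_int q * \<theta> i * of_int (b e $ i)) = 0"
      by (simp add: mult.assoc flip: sum_distrib_left)
    then have "\<bar>real_of_int (idot k (b e))\<bar>
        = \<bar>\<Sum>i\<in>UNIV. (of_int q * \<theta> i - of_int (k $ i)) * of_int (b e $ i)\<bar>"
      by (simp add: idot_def left_diff_distrib sum_subtractf)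
    also have "\<dots> \<le> (\<Sum>i\<in>UNIV. \<bar>of_int q * \<theta> i - of_int (k $ i)\<bar> * \<bar>of_int (b e $ i)\<bar>)"
      by (rule order_trans[OF sum_abs]) (simp add: abs_mult)
    also have "\<dots> \<le> (\<Sum>i\<in>UNIV. (1 / N) * \<bar>of_int (b e $ i)\<bar>)"
      using k by (intro sum_mono mult_right_mono) (auto intro: less_imp_le)
    also have "\<dots> = of_int (\<Sum>i\<in>UNIV. \<bar>b e $ i\<bar>) / N"
      by (simp add: sum_divide_distrib)
    also have "\<dots> < 1"
    proof -
      have "(\<Sum>i\<in>UNIV. \<bar>b e $ i\<bar>) \<le> (\<Sum>e\<in>E. \<Sum>i\<in>UNIV. \<bar>b e $ i\<bar>)"
        by (rule member_le_sum) (use that assms(1) in \<open>auto intro: sum_nonneg\<close>)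
      also have "\<dots> < int N" by (simp add: N_def)
      finally have "real_of_int (\<Sum>i\<in>UNIV. \<bar>b e $ i\<bar>) < real N"
        by (metis of_int_less_iff of_int_of_nat_eq)
      then show ?thesis using \<open>N > 0\<close> by (simp del: of_int_sum)
    qed
    finally show ?thesis by linarith
  qed
  ultimately show thesis by (rule that)
qed

definition edge_vector :: "('n \<Rightarrow> 'e \<Rightarrow> int) \<Rightarrow> 'e \<Rightarrow> int ^ 'n" where
  "edge_vector B e = (\<chi> i. B i e)"

lemma riemann_matrix_eq_rank_one_sum:
  "riemann_matrix G l B = rank_one_sum (arcs G) l (edge_vector B)"
  by (simp add: riemann_matrix_def rank_one_sum_def edge_vector_def vec_eq_iff)

lemma idot_edge_vector: "idot w (edge_vector B e) = (\<Sum>i\<in>UNIV. w $ i * B i e)"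
  by (simp add: idot_def edge_vector_def)

text \<open>
  Uniqueness of coordinates in a cycle basis gives definiteness over the integers, hence over the
  reals. For the small lift of \<open>u\<close>, reorient the cycle with coordinates \<open>u\<close> into a cycle \<open>z\<close> with
  entries \<open>0\<close> and \<open>\<plusminus>1\<close>. Half the difference of the two is again an integral cycle, so the
  coordinates of \<open>z\<close> are congruent to \<open>u\<close> modulo 2.
\<close>

lemma cycle_basis_dicing:
  fixes B :: "4 \<Rightarrow> 'e \<Rightarrow> int"
  assumes "metric_graph G l" "cycle_basis G B"
  shows "dicing (arcs G) l (edge_vector B)"
proof
  have G: "fin_digraph G" and l: "\<And>e. e \<in> arcs G \<Longrightarrow> l e > 0"
    using assms(1) by (auto simp: metric_graph_def)
  interpret fin_digraph G by (fact G)
  have B: "B i \<in> H1 G" for i using assms(2) by (simp add: cycle_basis_def)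
  have basis: "\<exists>!a. c = (\<lambda>e. \<Sum>i\<in>UNIV. a i * B i e)" if "c \<in> H1 G" for c
    using assms(2) that by (simp add: cycle_basis_def)
  show "finite (arcs G)" by simp
  show "l e > 0" if "e \<in> arcs G" for e using l that .
  show "x = 0" if x: "\<forall>e\<in>arcs G. x \<bullet> real_vec (edge_vector B e) = 0" for x :: "real ^ 4"
  proof (rule ccontr)
    assume "x \<noteq> 0"
    then obtain k where k: "k \<noteq> 0" "\<And>e. e \<in> arcs G \<Longrightarrow> idot k (edge_vector B e) = 0"
      using integral_relation_of_real_relation[of "arcs G" x "edge_vector B"] x by auto
    have k0: "(\<Sum>i\<in>UNIV. k $ i * B i e) = 0" for e
      using k(2)[of e] B G by (cases "e \<in> arcs G") (auto simp: idot_edge_vector H1_iff)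
    have "(\<lambda>e. 0) \<in> H1 G" by (simp add: H1_def)
    from basis[OF this] have "($) k = (\<lambda>i. 0)"
      by (rule Uniq_D[OF ex1_iff_ex_Uniq[THEN iffD1, THEN conjunct2]]) (simp_all add: k0)
    then show False using k(1) by (simp add: vec_eq_iff fun_eq_iff)
  qed
  show "\<exists>w. mod2 w = u \<and> (\<forall>e\<in>arcs G. \<bar>idot w (edge_vector B e)\<bar> \<le> 1)" for u
  proof -
    define y where "y e = (\<Sum>i\<in>UNIV. lift_int u $ i * B i e)" for e
    have y: "y \<in> H1 G" unfolding y_def by (rule H1_sum[OF G]) (use B in auto)
    then obtain z where z: "z \<in> H1 G" "\<And>e. \<bar>z e\<bar> \<le> 1" "\<And>e. even (z e - y e)"
      using eulerian_orientation[OF G] by blast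
    define d where "d e = (z e - y e) div 2" for e
    have zd: "z e = y e + 2 * d e" for e using z(3)[of e] by (simp add: d_def)
    have "2 * net_inflow (tail G) (head G) (arcs G) d v
       = net_inflow (tail G) (head G) (arcs G) z v - net_inflow (tail G) (head G) (arcs G) y v" for v
      by (simp add: net_inflow_def zd distrib_right sum.distrib sum_distrib_left mult.assoc)
    then have "d \<in> H1 G" using y z(1) G zd by (auto simp: H1_iff)
    then obtain a where a: "d = (\<lambda>e. \<Sum>i\<in>UNIV. a i * B i e)" using basis by blast
    define w where "w = (\<chi> i. lift_int u $ i + 2 * a i)"
    have "idot w (edge_vector B e) = z e" for e
      by (simp add: idot_edge_vector w_def zd y_def a distrib_right sum.distrib
          sum_distrib_left mult.assoc)
    moreover have "mod2 w = u"
      by (simp add: mod2_def w_def lift_int_def vec_eq_iff of_int_bit)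
    ultimately show ?thesis using z(2) by auto
  qed
qed


section \<open>Counting edge classes of a graph\<close>

text \<open>
  A graph with vertex set \<open>V\<close> and edge set \<open>F\<close> has at least \<open>|V| - |F|\<close> components, because each new
  edge merges at most two of them. A labelling is all that is needed of the components.
\<close>

lemma labelling_constant_along_edges:
  assumes "finite V" "finite F"
  shows "\<exists>label :: 'v \<Rightarrow> 'v. (\<forall>e\<in>F. label (t e) = label (h e)) \<and> card V \<le> card (label ` V) + card F"
  using assms(2)
proof (induction rule: finite_induct)
  case empty
  show ?case by (intro exI[of _ id]) simp
next
  case (insert e F)
  then obtain label :: "'v \<Rightarrow> 'v" where
    label: "\<And>f. f \<in> F \<Longrightarrow> label (t f) = label (h f)" "card V \<le> card (label ` V) + card F"
    by auto
  define label' where "label' v = (if label v = label (h e) then label (t e) else label v)" for v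
  have "label ` V - {label (h e)} \<subseteq> label' ` V" by (auto simp: label'_def)
  then have "card (label ` V) - 1 \<le> card (label' ` V)"
    using assms(1) card_mono[of "label' ` V" "label ` V - {label (h e)}"]
    by (cases "label (h e) \<in> label ` V") auto
  then have "card V \<le> card (label' ` V) + card (insert e F)"
    using label(2) insert.hyps by simp
  moreover have "\<forall>f\<in>insert e F. label' (t f) = label' (h f)"
    using label(1) by (auto simp: label'_def)
  ultimately show ?case by blast
qed

definition edge_class :: "('n \<Rightarrow> 'e \<Rightarrow> int) \<Rightarrow> 'e \<Rightarrow> bit ^ 'n" where
  "edge_class B e = mod2 (edge_vector B e)"

text \<open>
  Every basis cycle crosses a cut with total flow zero, and modulo 2 the direction of crossing does
  not matter.
\<close>

lemma sum_edge_class_cut: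
  assumes "fin_digraph G" "\<And>i. B i \<in> H1 G"
  shows "(\<Sum>e\<in>{e\<in>arcs G. (head G e \<in> K) \<noteq> (tail G e \<in> K)}. edge_class B e) = 0"
proof -
  interpret fin_digraph G by fact
  have "(\<Sum>e\<in>{e\<in>arcs G. (head G e \<in> K) \<noteq> (tail G e \<in> K)}. of_int (B i e) :: bit) = 0" for i
  proof -
    have "(\<Sum>e\<in>arcs G. B i e * (of_bool (head G e \<in> K) - of_bool (tail G e \<in> K))) = 0"
      using assms by (intro circulation_across_cut) (auto simp: H1_iff)
    then have "of_int (\<Sum>e\<in>arcs G. B i e * (of_bool (head G e \<in> K) - of_bool (tail G e \<in> K)))
        = (0 :: bit)" by simp
    then have "(\<Sum>e\<in>arcs G. of_int (B i e * (of_bool (head G e \<in> K) - of_bool (tail G e \<in> K))))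
        = (0 :: bit)" by (simp only: of_int_sum)
    also have "(\<Sum>e\<in>arcs G. of_int (B i e * (of_bool (head G e \<in> K) - of_bool (tail G e \<in> K))) :: bit)
        = (\<Sum>e\<in>arcs G. if (head G e \<in> K) \<noteq> (tail G e \<in> K) then of_int (B i e) else 0)"
      by (rule sum.cong) (auto simp: of_int_bit)
    finally show ?thesis by (simp add: sum.inter_filter)
  qed
  then show ?thesis
    by (simp add: vec_eq_iff edge_class_def mod2_def edge_vector_def)
qed

lemma card_zero_sum_ge_3:
  assumes "finite C" "C \<noteq> {}" "inj_on f C" "\<And>e. e \<in> C \<Longrightarrow> f e \<noteq> (0 :: bit ^ 'n)" "(\<Sum>e\<in>C. f e) = 0"
  shows "card C \<ge> 3"
proof -
  have "card C \<noteq> 0" using assms(1,2) by simp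
  moreover have "card C \<noteq> 1" using assms(4,5) by (auto simp: card_1_singleton_iff)
  moreover have "card C \<noteq> 2"
    using assms(3,5) by (auto simp: card_2_iff bit_vec_add_eq_0_iff)
  ultimately show ?thesis by linarith
qed

lemma connected_edge_across_cut:
  assumes "wf_digraph G" "Digraph_Component.connected G"
    and "a \<in> verts G" "a \<in> K" "b \<in> verts G" "b \<notin> K"
  shows "\<exists>e\<in>arcs G. (head G e \<in> K) \<noteq> (tail G e \<in> K)"
proof (rule ccontr)
  interpret wf_digraph G by fact
  assume no: "\<not> ?thesis"
  have "a \<rightarrow>\<^sup>*\<^bsub>mk_symmetric G\<^esub> b"
    using assms by (auto simp: connected_def strongly_connected_def)
  then have "b \<in> K"
    unfolding reachable_def
  proof (induction rule: rtrancl_on_induct)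
    case base
    then show ?case using assms(4) by simp
  next
    case (step x y)
    then show ?case using no by (auto simp: parcs_mk_symmetric arcs_ends_conv)
  qed
  then show False using assms(6) by simp
qed

text \<open>
  A stable graph of genus \<open>g\<close> has at most \<open>3g - 3\<close> edges, as all its vertices have valence at least 3.
  The same count applies to the edges in \<open>S\<close> after contraction of all other edges.
  The contracted graph has at least \<open>|S| - g + 1\<close> vertices, represented by the labels of a labelling
  that is constant along the other edges. The edges at a vertex form a cut of the original graph,
  so their classes sum to zero. Connectedness makes the cut nonempty, and as the classes are nonzero
  and distinct, there are at least three of them. Each edge is counted at most twice.
\<close>

theorem card_edge_classes_le:
  fixes G :: "('v, 'e) pre_digraph" and B :: "'n::finite \<Rightarrow> 'e \<Rightarrow> int"
  assumes G: "fin_digraph G" "Digraph_Component.connected G" "genus G \<ge> 2"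
    and B: "\<And>i. B i \<in> H1 G"
    and S: "S \<subseteq> arcs G" "inj_on (edge_class B) S" "\<And>e. e \<in> S \<Longrightarrow> edge_class B e \<noteq> 0"
  shows "int (card S) \<le> 3 * genus G - 3"
proof -
  interpret fin_digraph G by (fact G(1))
  have finS: "finite S" using S(1) by (rule finite_subset) simp
  obtain label :: "'v \<Rightarrow> 'v" where
    label: "\<And>e. e \<in> arcs G - S \<Longrightarrow> label (tail G e) = label (head G e)"
    and card_label: "card (verts G) \<le> card (label ` verts G) + card (arcs G - S)"
    using labelling_constant_along_edges[of "verts G" "arcs G - S" "tail G" "head G"] by auto
  let ?k = "card (label ` verts G)"
  have "card (arcs G - S) + card S = card (arcs G)"
    using S(1) by (metis card_Diff_subset card_mono finS finite_arcs le_add_diff_inverse2)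
  then have n: "int (card S) \<le> ?k + genus G - 1"
    using card_label by (simp add: genus_def)
  show ?thesis
  proof (cases "?k \<le> 1")
    case True
    then show ?thesis using n G(3) by linarith
  next
    case False
    \<comment> \<open>The valence of the contracted vertex \<open>x\<close> is at least 3.\<close>
    have cut: "3 \<le> card {e\<in>S. (label (head G e) = x) \<noteq> (label (tail G e) = x)}"
      if x: "x \<in> label ` verts G" for x
    proof -
      let ?K = "{v. label v = x}" and ?C = "{e\<in>S. (label (head G e) = x) \<noteq> (label (tail G e) = x)}"
      have C: "?C = {e\<in>arcs G. (head G e \<in> ?K) \<noteq> (tail G e \<in> ?K)}"
        using S(1) label by fastforce
      obtain a where "a \<in> verts G" "a \<in> ?K" using x by auto
      moreover obtain b where "b \<in> verts G" "b \<notin> ?K"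
      proof -
        have "\<not> label ` verts G \<subseteq> {x}"
          using False card_mono[of "{x}" "label ` verts G"] by auto
        then show thesis using that by auto
      qed
      ultimately have "?C \<noteq> {}"
        using connected_edge_across_cut[OF _ G(2), of a ?K b] wf_digraph_axioms unfolding C by auto
      moreover have "(\<Sum>e\<in>?C. edge_class B e) = 0"
        unfolding C using G(1) B by (rule sum_edge_class_cut)
      ultimately show ?thesis
        using finS S(2,3) by (intro card_zero_sum_ge_3[of _ "edge_class B"]) (auto intro: inj_on_subset)
    qed
    have "3 * ?k = (\<Sum>x\<in>label ` verts G. 3)" by simp
    also have "\<dots> \<le> (\<Sum>x\<in>label ` verts G.
        card {e\<in>S. (label (head G e) = x) \<noteq> (label (tail G e) = x)})"
      by (rule sum_mono) (rule cut)
    also have "\<dots> = (\<Sum>x\<in>label ` verts G. \<Sum>e\<in>S. of_bool ((label (head G e) = x) \<noteq> (label (tail G e) = x)))"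
      using finS by (simp add: Int_def)
    also have "\<dots> \<le> (\<Sum>x\<in>label ` verts G. \<Sum>e\<in>S. of_bool (label (head G e) = x) + of_bool (label (tail G e) = x))"
      by (intro sum_mono) auto
    also have "\<dots> = (\<Sum>e\<in>S. \<Sum>x\<in>label ` verts G. of_bool (label (head G e) = x) + of_bool (label (tail G e) = x))"
      by (rule sum.swap)
    also have "\<dots> = (\<Sum>e\<in>S. 2)"
      using S(1) by (intro sum.cong refl) (auto simp: sum.distrib of_bool_def)
    finally have "3 * ?k \<le> 2 * card S" by simp
    then show ?thesis using n by linarith
  qed
qed

text \<open>
  By \<open>vartheta_Q\<close>, each positive theta constant comes from an edge in the corresponding class.
\<close>

theorem J4_trop_card_vartheta_pos:
  assumes "Q \<in> J4_trop"
  shows "card {v. v \<noteq> 0 \<and> vartheta v Q > 0} \<le> 9"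
proof -
  obtain G :: "(nat, nat) pre_digraph" and l and B :: "4 \<Rightarrow> nat \<Rightarrow> int" where
    Q: "Q = riemann_matrix G l B" and G: "metric_graph G l" "genus G = 4" "cycle_basis G B"
    using assms unfolding J4_trop_def by blast
  interpret dicing "arcs G" l "edge_vector B" using G(1,3) by (rule cycle_basis_dicing)
  let ?P = "{v. v \<noteq> 0 \<and> vartheta v Q > 0}"
  define s where "s v = (SOME e. e \<in> arcs G \<and> edge_class B e = v)" for v
  have s: "s v \<in> arcs G \<and> edge_class B (s v) = v" if "v \<in> ?P" for v
  proof -
    have "(\<Sum>e\<in>{e\<in>arcs G. edge_class B e = v}. l e) > 0"
      using that vartheta_Q[of v] by (simp add: Q riemann_matrix_eq_rank_one_sum edge_class_def)
    then have "{e\<in>arcs G. edge_class B e = v} \<noteq> {}" by (metis less_irrefl sum.empty)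
    then have "\<exists>e. e \<in> arcs G \<and> edge_class B e = v" by auto
    then show ?thesis unfolding s_def by (rule someI_ex)
  qed
  have "inj_on s ?P" by (rule inj_on_inverseI[of _ "edge_class B"]) (use s in blast)
  then have "card (s ` ?P) = card ?P" by (rule card_image)
  moreover have "int (card (s ` ?P)) \<le> 3 * genus G - 3"
    by (rule card_edge_classes_le[where B = B])
      (use G s in \<open>auto simp: metric_graph_def cycle_basis_def intro!: inj_onI\<close>)
  ultimately show ?thesis using G(2) by simp
qed


section \<open>Hyperplanes over the two-element field\<close>

text \<open>
  A nonzero kernel vector extends to a basis of \<open>N\<close> of which one vector is wasted in the image.
\<close>

lemma inj_on_of_dim_image_eq:
  fixes f :: "'a::field ^ 'n \<Rightarrow> 'a ^ 'm"
  assumes lin: "Vector_Spaces.linear (*s) (*s) f" and N: "vec.subspace N"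
    and dim: "vec.dim (f ` N) = vec.dim N"
  shows "inj_on f N"
proof -
  interpret f: Vector_Spaces.linear "(*s)" "(*s)" f by (fact lin)
  have ker: "n = 0" if n: "n \<in> N" "f n = 0" for n
  proof (rule ccontr)
    assume "n \<noteq> 0"
    then have "vec.independent {n}" by simp
    then obtain B where B: "{n} \<subseteq> B" "B \<subseteq> N" "vec.independent B" "N \<subseteq> vec.span B"
      using vec.maximal_independent_subset_extend[of "{n}" N] n(1) by auto
    have "finite B" using B(3) by (rule vec.finiteI_independent)
    have "f ` B \<subseteq> insert 0 (f ` (B - {n}))" using n(2) by auto
    then have "vec.span (f ` B) \<subseteq> vec.span (f ` (B - {n}))"
      by (metis vec.span_insert_0 vec.span_mono)
    then have "f ` N \<subseteq> vec.span (f ` (B - {n}))"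
      using B(4) vec.linear_span_image[OF lin] by blast
    then have "vec.dim (f ` N) \<le> card (f ` (B - {n}))"
      by (rule vec.dim_le_card) (use \<open>finite B\<close> in simp)
    also have "\<dots> \<le> card (B - {n})" using \<open>finite B\<close> by (intro card_image_le) auto
    also have "\<dots> < card B" using B(1) \<open>finite B\<close> by (intro psubset_card_mono) auto
    also have "card B = vec.dim N" using B by (intro vec.basis_card_eq_dim) auto
    finally show False using dim by simp
  qed
  show ?thesis
  proof (rule inj_onI)
    fix a b assume "a \<in> N" "b \<in> N" "f a = f b"
    then have "a - b \<in> N" "f (a - b) = 0" using N by (auto simp: vec.subspace_diff f.diff)
    then show "a = b" using ker by force
  qed
qed

definition perp :: "bit ^ 'n \<Rightarrow> (bit ^ 'n) set" where
  "perp v = {u. dot2 u v = 0}"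

lemma subspace_perp: "vec.subspace (perp v)"
  by (auto simp: subspace_bit_iff perp_def dot2_add_left simp del: add_bit_eq_xor)
     (simp add: dot2_def)

text \<open>
  Extend a basis of \<open>S\<close> by one vector \<open>p\<close>. The linear form that is 1 at \<open>p\<close> and 0 on \<open>S\<close> is the
  product with some vector \<open>v\<close>.
\<close>

lemma hyperplane_is_perp:
  fixes S :: "(bit ^ 'n) set"
  assumes S: "vec.subspace S" "vec.dim S + 1 = CARD('n)"
  obtains v where "v \<noteq> 0" "S = perp v"
proof -
  obtain B where B: "B \<subseteq> S" "vec.independent B" "S \<subseteq> vec.span B" "card B = vec.dim S"
    using vec.basis_exists by blast
  have "S \<noteq> UNIV" using S(2) vec_dim_card[where 'a = bit and 'n = 'n] by force
  then obtain p where p: "p \<notin> S" by auto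
  have "vec.span B = S"
    using B(1,3) S(1) by (simp add: subset_antisym vec.span_minimal)
  then have "vec.independent (insert p B)" using p B(2) by (simp add: vec.independent_insertI)
  \<comment> \<open>A linear form is encoded as a map into the one-dimensional space \<open>bit ^ 1\<close>.\<close>
  then obtain g :: "bit ^ 'n \<Rightarrow> bit ^ 1" where
    g: "Vector_Spaces.linear (*s) (*s) g" "\<forall>x\<in>insert p B. g x = (if x = p then 1 else 0)"
    using vec.linear_independent_extend[of "insert p B" "\<lambda>x. if x = p then 1 else 0"] by blast
  define v where "v = (\<chi> j. g (axis j 1) $ 1)"
  have gv: "g x $ 1 = dot2 x v" for x
  proof -
    have "g x $ 1 = (matrix g *v x) $ 1" using matrix_works[OF g(1)] by simp
    then show ?thesis
      by (simp add: matrix_vector_mult_def matrix_def dot2_def v_def mult.commute del: mult_bit_eq_and)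
  qed
  have "g p = 1" using g(2) by simp
  then have "dot2 p v = 1" using gv[of p] by simp
  then have "v \<noteq> 0" "p \<notin> perp v" by (auto simp: perp_def)
  have "g x = 0" if "x \<in> S" for x
  proof (rule vec.linear_eq_0_on_span[OF g(1), of B])
    show "\<And>x. x \<in> B \<Longrightarrow> g x = 0" using g(2) p B(1) by auto
    show "x \<in> vec.span B" using that B(3) by blast
  qed
  then have "S \<subseteq> perp v" using gv by (auto simp: perp_def) (metis zero_index)
  moreover have "vec.dim (perp v) \<le> vec.dim S"
  proof (rule ccontr)
    assume "\<not> ?thesis"
    then have "vec.dim (UNIV :: (bit ^ 'n) set) \<le> vec.dim (perp v)"
      using S(2) by (simp only: vec_dim_card)
    then have "perp v = UNIV" using vec.subspace_dim_equal[OF subspace_perp vec.subspace_UNIV] by blast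
    then show False using \<open>p \<notin> perp v\<close> by simp
  qed
  ultimately have "S = perp v"
    using vec.subspace_dim_equal[OF S(1) subspace_perp] by blast
  then show thesis using \<open>v \<noteq> 0\<close> that by blast
qed

lemma dim_perp:
  fixes v :: "bit ^ 'n"
  assumes "v \<noteq> 0"
  shows "vec.dim (perp v) + 1 = CARD('n)"
proof -
  obtain p where p: "dot2 p v = 1" using assms by (rule ex_dot2_eq_1)
  have span: "vec.span (perp v) = perp v" using subspace_perp by simp
  have "u \<in> vec.span (insert p (perp v))" for u
  proof (cases "dot2 u v = 0")
    case True
    then show ?thesis by (simp add: vec.span_base perp_def)
  next
    case False
    then have "u + p \<in> perp v" using p by (simp add: perp_def dot2_add_left)
    then have "(u + p) + p \<in> vec.span (insert p (perp v))"
      by (intro vec.span_add vec.span_base) auto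
    then show ?thesis by (simp add: add.assoc)
  qed
  then have "vec.span (insert p (perp v)) = UNIV" by auto
  then have "vec.dim (insert p (perp v)) = CARD('n)" by (metis vec.dim_span vec_dim_card)
  moreover have "p \<notin> vec.span (perp v)" unfolding span by (simp add: perp_def p)
  ultimately show ?thesis by (simp add: vec.dim_insert)
qed

text \<open>
  The double annihilator of the line spanned by \<open>v\<close>. Modulo \<open>v\<^sup>\<bottom>\<close> there is only one nonzero class,
  so a linear form vanishing on \<open>v\<^sup>\<bottom>\<close> is determined by its value there.
\<close>

lemma perp_annihilator:
  assumes "v \<noteq> (0 :: bit ^ 'n)" "\<And>u. u \<in> perp v \<Longrightarrow> dot2 u w = 0"
  shows "w = 0 \<or> w = v"
proof (cases "w = 0")
  case False
  obtain p where p: "dot2 p v = 1" using assms(1) by (rule ex_dot2_eq_1)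
  have eq: "dot2 u w = dot2 p w * dot2 u v" for u
  proof (cases "dot2 u v = 0")
    case True
    then show ?thesis using assms(2)[of u] by (simp add: perp_def)
  next
    case False
    then have "u + p \<in> perp v" using p by (simp add: perp_def dot2_add_left)
    then have "dot2 u w + dot2 p w = 0" using assms(2) by (simp only: dot2_add_left[symmetric])
    then show ?thesis using False by (cases "dot2 u w"; cases "dot2 p w") auto
  qed
  obtain q where "dot2 q w = 1" using False by (rule ex_dot2_eq_1)
  then have "dot2 p w = 1" using eq[of q] by (cases "dot2 p w") auto
  then have "dot2 (axis i 1) w = dot2 (axis i 1) v" for i
    by (simp only: eq[of "axis i 1"] mult_1_left)
  then have "w $ i = v $ i" for i by (metis dot2_axis dot2_commute)
  then show ?thesis by (simp add: vec_eq_iff)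
qed simp

section \<open>Admissible choices\<close>

lemma fst_half_add: "fst_half (m + n) = fst_half m + fst_half n"
  and snd_half_add: "snd_half (m + n) = snd_half m + snd_half n"
  by (simp_all add: fst_half_def snd_half_def vec_eq_iff)

definition join :: "bit ^ 4 \<Rightarrow> bit ^ 4 \<Rightarrow> characteristic" where
  "join u w = (\<chi> x. case x of Inl i \<Rightarrow> u $ i | Inr i \<Rightarrow> w $ i)"

lemma fst_half_join [simp]: "fst_half (join u w) = u"
  and snd_half_join [simp]: "snd_half (join u w) = w"
  by (simp_all add: join_def fst_half_def snd_half_def vec_eq_iff)

lemma linear_fst_half: "Vector_Spaces.linear (*s) (*s) fst_half"
  by unfold_locales (simp_all add: fst_half_def vec_eq_iff algebra_simps)

lemma characteristic_eqI: "fst_half m = fst_half n \<Longrightarrow> snd_half m = snd_half n \<Longrightarrow> m = n"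
  by (auto simp: fst_half_def snd_half_def vec_eq_iff) (metis sum.exhaust_sel)

text \<open>
  The exponent of the sign, so that products of signs become sums over the two-element field.
\<close>

definition parity :: "characteristic \<Rightarrow> bit" where
  "parity m = dot2 (fst_half m) (snd_half m)"

lemma char_sign_eq_1_iff: "char_sign m = 1 \<longleftrightarrow> parity m = 0"
  by (cases "parity m") (simp_all add: char_sign_def parity_def)

lemma azygetic_iff:
  "azygetic m\<^sub>1 m\<^sub>2 m\<^sub>3 \<longleftrightarrow> parity m\<^sub>1 + parity m\<^sub>2 + parity m\<^sub>3 + parity (m\<^sub>1 + m\<^sub>2 + m\<^sub>3) = 1"
proof -
  have s: "char_sign m = (if parity m = 0 then 1 else -1)" for m
    by (cases "parity m") (simp_all add: char_sign_def parity_def)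
  show ?thesis unfolding azygetic_def s by (auto split: if_splits)
qed


text \<open>
  The hyperplane \<open>N'\<close> is \<open>v\<^sup>\<bottom>\<close> for some \<open>v\<close>, and exactly one of the three first halves lies outside it.
  Conceptually, \<open>N\<close> is isotropic for the symplectic form on \<open>(\<int>/2)\<^sup>8\<close> and the \<open>m\<^sub>i\<close> are the three even
  ones among the four cosets of \<open>N\<close> in \<open>m\<^sub>1 + N\<^sup>\<bottom>\<close>. Translation by \<open>(0, v)\<close> permutes the four cosets and
  changes the sign precisely outside \<open>v\<^sup>\<bottom>\<close>. So the two cosets over \<open>v\<^sup>\<bottom>\<close> have equal signs, the other
  two have opposite signs, and the odd coset lies outside.
\<close>

lemma admissible_structure:
  assumes adm: "admissible m N"
  obtains v i\<^sub>0 where "v \<noteq> 0" "fst_half ` N = perp v" "inj_on fst_half N" "i\<^sub>0 \<in> {1..3}"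
    "\<And>i. i \<in> {1..3} \<Longrightarrow> dot2 (fst_half (m i)) v = of_bool (i = i\<^sub>0)"
proof -
  have N: "vec.subspace N" "vec.dim N = 3" "vec.dim (fst_half ` N) = 3"
    and az: "azygetic (m 1) (m 2) (m 3)"
    using adm by (auto simp: admissible_def)
  have even: "parity (m i + n) = 0" if "i \<in> {1..3}" "n \<in> N" for i n
    using adm that by (auto simp: admissible_def char_coset_def char_sign_eq_1_iff)
  have "0 \<in> N" using N(1) by (rule vec.subspace_0)
  have inj: "inj_on fst_half N"
    using inj_on_of_dim_image_eq[OF linear_fst_half N(1)] N by simp
  have "vec.subspace (fst_half ` N)"
    using linear_fst_half N(1) by (rule vec.linear_subspace_image)
  then obtain v where v: "v \<noteq> 0" "fst_half ` N = perp v"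
    using hyperplane_is_perp[of "fst_half ` N"] N(3) by auto
  \<comment> \<open>Otherwise \<open>m\<^sub>1 + m\<^sub>2 + m\<^sub>3\<close> would lie in a coset \<open>m\<^sub>k + N\<close> and would be even.\<close>
  have distinct: "m i + m j \<notin> N" if ij: "i \<in> {1..3}" "j \<in> {1..3}" "i \<noteq> j" for i j
  proof
    assume ij_N: "m i + m j \<in> N"
    obtain k where k: "k \<in> {1..3}" "m 1 + m 2 + m 3 = m k + (m i + m j)"
    proof -
      have "i = 1 \<or> i = 2 \<or> i = 3" "j = 1 \<or> j = 2 \<or> j = 3"
        using ij(1,2) unfolding atLeastAtMost_iff by presburger+
      then show thesis
        using ij(3) that[of 1] that[of 2] that[of 3] by (elim disjE) (simp_all add: add_ac)
    qed
    have "parity (m i) = 0" if "i \<in> {1..3}" for i using even[OF that \<open>0 \<in> N\<close>] by simp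
    then have "parity (m 1 + m 2 + m 3) = 1" using az by (simp add: azygetic_iff)
    then show False using even[OF k(1) ij_N] k(2) by simp
  qed
  \<comment> \<open>Two characteristics whose first halves agree modulo \<open>N'\<close> differ by \<open>(0, w)\<close> modulo \<open>N\<close>.
    Comparing the two even cosets, \<open>w\<close> annihilates all first halves in \<open>m\<^sub>i + N\<close>; it is not zero, so \<open>w = v\<close>,
    and the common first half lies in \<open>v\<^sup>\<bottom>\<close>.\<close>
  have shift: "m i + m j + join 0 v \<in> N \<and> dot2 (fst_half (m i)) v = 0"
    if ij: "i \<in> {1..3}" "j \<in> {1..3}" "i \<noteq> j"
      and same: "dot2 (fst_half (m i)) v = dot2 (fst_half (m j)) v" for i j
  proof -
    have "fst_half (m i + m j) \<in> perp v"
      using same by (simp add: perp_def fst_half_add dot2_add_left del: add_bit_eq_xor)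
    then obtain n where n: "n \<in> N" "fst_half n = fst_half (m i + m j)"
      using v(2) by (metis imageE)
    define w where "w = snd_half (m i + m j + n)"
    have "fst_half (m i + m j + n) = 0" using n(2) by (simp only: fst_half_add bit_vec_add_self)
    then have mij: "m i + m j + n = join 0 w"
      by (intro characteristic_eqI) (simp_all add: w_def)
    have orth: "dot2 (fst_half (m i + k)) w = 0" if k: "k \<in> N" for k
    proof -
      have "m j + (k + n) = (m i + m i) + m j + n + k" by (simp add: add_ac)
      also have "\<dots> = (m i + k) + (m i + m j + n)" by (simp only: add_ac)
      finally have "m j + (k + n) = (m i + k) + join 0 w" by (simp only: mij)
      then have "parity (m j + (k + n)) = parity (m i + k) + dot2 (fst_half (m i + k)) w"
        by (simp only: parity_def fst_half_add snd_half_add fst_half_join snd_half_join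
            add_0_right dot2_add_right)
      moreover have "k + n \<in> N" using k n(1) N(1) by (rule vec.subspace_add[rotated])
      ultimately show ?thesis using even[OF ij(1) k] even[OF ij(2)] by simp
    qed
    have "dot2 u w = 0" if "u \<in> perp v" for u
    proof -
      have "u \<in> fst_half ` N" using that v(2) by simp
      then obtain k where k: "k \<in> N" "u = fst_half k" by (elim imageE)
      have "dot2 (fst_half (m i)) w = 0" using orth[OF \<open>0 \<in> N\<close>] by simp
      then show ?thesis using orth[OF k(1)] k(2) by (simp add: fst_half_add dot2_add_left)
    qed
    then have "w = 0 \<or> w = v" using perp_annihilator v(1) by blast
    moreover have "w \<noteq> 0"
    proof
      assume "w = 0"
      then have "m i + m j + n = 0"
        using mij by (metis characteristic_eqI fst_half_join snd_half_join fst_half_add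
            snd_half_add bit_vec_add_self)
      then have "m i + m j = n" by (simp only: bit_vec_add_eq_0_iff)
      then show False using distinct[OF ij] n(1) by simp
    qed
    ultimately have "w = v" by simp
    have "m i + m j + join 0 v = (m i + m i) + (m j + m j) + n"
      unfolding \<open>w = v\<close>[symmetric] mij[symmetric] by (simp only: add_ac)
    then have "m i + m j + join 0 v \<in> N" using n(1) by simp
    moreover have "dot2 (fst_half (m i)) v = 0" using orth[OF \<open>0 \<in> N\<close>] \<open>w = v\<close> by simp
    ultimately show ?thesis by simp
  qed
  \<comment> \<open>Not all three first halves lie in \<open>v\<^sup>\<bottom>\<close>: the differences \<open>m\<^sub>1 + m\<^sub>2\<close> and \<open>m\<^sub>1 + m\<^sub>3\<close> would both
    be \<open>(0, v)\<close> modulo \<open>N\<close>, and \<open>m\<^sub>2 + m\<^sub>3\<close> would lie in \<open>N\<close>.\<close>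
  have "\<exists>i\<in>{1..3}. dot2 (fst_half (m i)) v = 1"
  proof (rule ccontr)
    assume "\<not> ?thesis"
    then have all0: "dot2 (fst_half (m i)) v = 0" if "i \<in> {1..3}" for i using that by auto
    have "m 1 + m 2 + join 0 v \<in> N" "m 1 + m 3 + join 0 v \<in> N"
      using shift[of 1 2] shift[of 1 3] all0[of 1] all0[of 2] all0[of 3] by auto
    then have "(m 1 + m 2 + join 0 v) + (m 1 + m 3 + join 0 v) \<in> N"
      using N(1) by (rule vec.subspace_add[rotated])
    also have "(m 1 + m 2 + join 0 v) + (m 1 + m 3 + join 0 v)
        = (m 1 + m 1) + (join 0 v + join 0 v) + (m 2 + m 3)" by (simp only: add_ac)
    also have "\<dots> = m 2 + m 3" by simp
    finally show False using distinct[of 2 3] by simp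
  qed
  then obtain i\<^sub>0 where i0: "i\<^sub>0 \<in> {1..3}" "dot2 (fst_half (m i\<^sub>0)) v = 1" by blast
  have "dot2 (fst_half (m i)) v = of_bool (i = i\<^sub>0)" if "i \<in> {1..3}" for i
    using shift[OF i0(1) that] i0(2) by (cases "dot2 (fst_half (m i)) v") auto
  then show thesis using that v inj i0(1) by blast
qed


section \<open>The tropical Igusa locus\<close>

lemma vartheta_eq_half_sums:
  "vartheta v Q = (\<Sum>u\<in>{u. dot2 u v = 0}. Theta_mod2 u Q) - (\<Sum>u\<in>{u. dot2 u v = 1}. Theta_mod2 u Q)"
proof -
  have U: "UNIV = {u. dot2 u v = 0} \<union> {u. dot2 u v = 1}" by auto
  show ?thesis
    unfolding vartheta_def by (subst U, subst sum.union_disjoint) (auto simp: sum_negf)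
qed

lemma pi_trop_eq_half_sum:
  assumes "fst_half ` N = perp v" "inj_on fst_half N"
  shows "pi_trop m N i Q = (\<Sum>u\<in>{u. dot2 u v = dot2 (fst_half (m i)) v}. Theta_mod2 u Q)"
proof -
  have "pi_trop m N i Q = (\<Sum>n\<in>N. Theta_mod2 (fst_half (m i) + fst_half n) Q)"
    unfolding pi_trop_def char_coset_def
    by (subst sum.reindex) (auto simp: inj_on_def fst_half_add)
  also have "\<dots> = (\<Sum>u\<in>perp v. Theta_mod2 (fst_half (m i) + u) Q)"
    unfolding assms(1)[symmetric] using assms(2) by (simp add: sum.reindex)
  also have "\<dots> = (\<Sum>u\<in>{u. dot2 u v = dot2 (fst_half (m i)) v}. Theta_mod2 u Q)"
    by (rule sum.reindex_bij_witness[of _ "\<lambda>u. fst_half (m i) + u" "\<lambda>u. fst_half (m i) + u"])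
       (auto simp: perp_def dot2_add_left simp flip: add.assoc)
  finally show ?thesis .
qed

text \<open>
  With the values \<open>a, a, b\<close> of the three forms, the maximum of the pairwise sums is \<open>2b\<close>, attained once,
  if \<open>b > a\<close>. Otherwise it is \<open>2a\<close>, attained at both diagonal pairs that belong to \<open>a\<close>.
\<close>

lemma breakpoint_locus_iff:
  assumes "i\<^sub>0 \<in> {1..3}" "\<And>i. i \<in> {1..3} \<Longrightarrow> pi_trop m N i Q = (if i = i\<^sub>0 then b else a)"
  shows "Q \<in> breakpoint_locus m N \<longleftrightarrow> Q \<in> H4_trop \<and> b \<le> a"
proof -
  define P where "P i = (if i = i\<^sub>0 then b else a)" for i :: nat
  have pair: "igusa_term m N p Q = P (fst p) + P (snd p)"
    "fst p \<in> {1..3}" "snd p \<in> {1..3}" if "p \<in> index_pairs" for p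
    using that assms(2) by (auto simp: igusa_term_def index_pairs_def P_def)
  have diag: "(i, i) \<in> index_pairs" if "i \<in> {1..3}" for i
    using that by (simp add: index_pairs_def)
  have "index_pairs \<subseteq> {1..3} \<times> {1..3}" by (auto simp: index_pairs_def)
  then have "finite index_pairs" by (rule finite_subset) simp
  then have max: "igusa_term m N p Q = igusa_form m N Q \<longleftrightarrow>
      (\<forall>r\<in>index_pairs. igusa_term m N r Q \<le> igusa_term m N p Q)" if "p \<in> index_pairs" for p
    unfolding igusa_form_def using that by (subst eq_commute, subst Max_eq_iff) auto
  show ?thesis
  proof
    assume Q: "Q \<in> breakpoint_locus m N"
    then obtain p q where pq: "p \<in> index_pairs" "q \<in> index_pairs" "p \<noteq> q"
      "igusa_term m N p Q = igusa_form m N Q" "igusa_term m N q Q = igusa_form m N Q"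
      by (auto simp: breakpoint_locus_def)
    have "b \<le> a"
    proof (rule ccontr)
      assume "\<not> b \<le> a"
      have "r = (i\<^sub>0, i\<^sub>0)" if r: "r \<in> index_pairs" "igusa_term m N r Q = igusa_form m N Q" for r
      proof -
        have "2 * b \<le> P (fst r) + P (snd r)"
          using max[OF r(1)] r(2) pair(1)[OF diag[OF assms(1)]] pair(1)[OF r(1)] diag[OF assms(1)]
          by (auto simp: P_def)
        then show ?thesis using \<open>\<not> b \<le> a\<close> by (cases r) (auto simp: P_def split: if_splits)
      qed
      then show False using pq by metis
    qed
    then show "Q \<in> H4_trop \<and> b \<le> a" using Q by (simp add: breakpoint_locus_def)
  next
    assume Q: "Q \<in> H4_trop \<and> b \<le> a"
    obtain j k where jk: "j \<in> {1..3}" "k \<in> {1..3}" "j \<noteq> k" "j \<noteq> i\<^sub>0" "k \<noteq> i\<^sub>0"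
    proof -
      have "i\<^sub>0 = 1 \<or> i\<^sub>0 = 2 \<or> i\<^sub>0 = 3"
        using assms(1) unfolding atLeastAtMost_iff by presburger
      then show thesis using that[of 1 2] that[of 1 3] that[of 2 3] by (elim disjE) simp_all
    qed
    have top: "igusa_term m N (i, i) Q = igusa_form m N Q" if i: "i \<in> {1..3}" "i \<noteq> i\<^sub>0" for i
    proof -
      have "igusa_term m N r Q \<le> igusa_term m N (i, i) Q" if "r \<in> index_pairs" for r
        using pair(1)[OF that] pair(1)[OF diag[OF i(1)]] Q i(2) by (simp add: P_def)
      then show ?thesis using max[OF diag[OF i(1)]] by blast
    qed
    have "\<exists>p\<in>index_pairs. \<exists>q\<in>index_pairs. p \<noteq> q \<and>
        igusa_term m N p Q = igusa_form m N Q \<and> igusa_term m N q Q = igusa_form m N Q"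
      by (rule bexI[of _ "(j, j)"], rule bexI[of _ "(k, k)"])
        (simp_all add: top[OF jk(1,4)] top[OF jk(2,5)] diag[OF jk(1)] diag[OF jk(2)] jk(3))
    then show "Q \<in> breakpoint_locus m N" using Q by (simp add: breakpoint_locus_def)
  qed
qed

text \<open>
  Two of the three forms are the sum of \<open>\<Theta>\<^sub>u\<close> over \<open>v\<^sup>\<bottom>\<close>, and the third is the sum over its complement.
  Their difference is \<open>\<vartheta>\<^sub>v\<close>.
\<close>

lemma breakpoint_locus_of_admissible:
  assumes "admissible m N"
  obtains v where "v \<noteq> 0" "fst_half ` N = perp v"
    "\<And>Q. Q \<in> breakpoint_locus m N \<longleftrightarrow> Q \<in> H4_trop \<and> vartheta v Q \<ge> 0"
proof -
  obtain v i\<^sub>0 where v: "v \<noteq> 0" "fst_half ` N = perp v" "inj_on fst_half N" "i\<^sub>0 \<in> {1..3}"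
    "\<And>i. i \<in> {1..3} \<Longrightarrow> dot2 (fst_half (m i)) v = of_bool (i = i\<^sub>0)"
    using admissible_structure[OF assms] by blast
  have "Q \<in> breakpoint_locus m N \<longleftrightarrow> Q \<in> H4_trop \<and> vartheta v Q \<ge> 0" for Q
    using breakpoint_locus_iff[of i\<^sub>0 m N Q "\<Sum>u\<in>{u. dot2 u v = 1}. Theta_mod2 u Q"
        "\<Sum>u\<in>{u. dot2 u v = 0}. Theta_mod2 u Q"] v
    by (simp add: pi_trop_eq_half_sum vartheta_eq_half_sums)
  then show thesis using v that by blast
qed

text \<open>
  Take \<open>N = v\<^sup>\<bottom> \<times> 0\<close> with the characteristics \<open>0\<close>, \<open>(0, v)\<close> and \<open>(p, 0)\<close>, where \<open>p \<bullet> v = 1\<close>. Their sum \<open>(p, v)\<close> is odd.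
\<close>

lemma ex_admissible:
  assumes "v \<noteq> 0"
  obtains m N where "admissible m N" "fst_half ` N = perp v"
proof -
  obtain p where p: "dot2 p v = 1" using assms by (rule ex_dot2_eq_1)
  define N where "N = (\<lambda>u. join u 0) ` perp v"
  define m :: "nat \<Rightarrow> characteristic" where
    "m i = (if i = 1 then 0 else if i = 2 then join 0 v else join p 0)" for i
  have lin: "Vector_Spaces.linear (*s) (*s) (\<lambda>u. join u 0)"
    by unfold_locales (auto simp: join_def vec_eq_iff split: sum.split)
  have fst: "fst_half ` N = perp v" by (simp add: N_def image_image)
  have "vec.dim (perp v) = 3" using dim_perp[OF assms] by simp
  moreover have "inj_on (\<lambda>u. join u 0) A" for A
    by (rule inj_on_inverseI[of _ fst_half]) simp
  ultimately have "vec.dim N = 3"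
    unfolding N_def using vec.dim_image_eq[OF lin] by simp
  moreover have "vec.subspace N"
    unfolding N_def using lin subspace_perp by (rule vec.linear_subspace_image)
  moreover have half0: "fst_half 0 = 0" "snd_half 0 = 0"
    by (simp_all add: fst_half_def snd_half_def vec_eq_iff)
  have "azygetic (m 1) (m 2) (m 3)"
    using p half0 by (simp add: azygetic_iff m_def parity_def fst_half_add snd_half_add)
  moreover have "char_sign c = 1" if "c \<in> char_coset (m i) N" for i c
    using that half0 by (auto simp: char_coset_def N_def m_def char_sign_eq_1_iff parity_def
        fst_half_add snd_half_add perp_def)
  ultimately have "admissible m N"
    using fst \<open>vec.dim (perp v) = 3\<close> by (simp add: admissible_def)
  then show thesis using fst by (rule that)
qed

theorem igusa_locus_iff:
  assumes "Q \<in> H4_trop"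
  shows "Q \<in> igusa_locus \<longleftrightarrow> (\<forall>v. v \<noteq> 0 \<longrightarrow> vartheta v Q \<ge> 0)"
proof
  assume Q: "Q \<in> igusa_locus"
  show "\<forall>v. v \<noteq> 0 \<longrightarrow> vartheta v Q \<ge> 0"
  proof (intro allI impI)
    fix v :: "bit ^ 4" assume "v \<noteq> 0"
    then obtain m N where adm: "admissible m N" and N: "fst_half ` N = perp v" by (rule ex_admissible)
    obtain v' where v': "v' \<noteq> 0" "fst_half ` N = perp v'"
      "Q \<in> breakpoint_locus m N \<longleftrightarrow> Q \<in> H4_trop \<and> vartheta v' Q \<ge> 0"
      using breakpoint_locus_of_admissible[OF adm] by metis
    moreover have "Q \<in> breakpoint_locus m N" using Q adm by (simp add: igusa_locus_def)
    moreover have "perp v = perp v'" using N v'(2) by simp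
    then have "v' = 0 \<or> v' = v"
      by (intro perp_annihilator[OF \<open>v \<noteq> 0\<close>]) (simp, simp add: perp_def)
    ultimately show "vartheta v Q \<ge> 0" using v'(1) by auto
  qed
next
  assume pos: "\<forall>v. v \<noteq> 0 \<longrightarrow> vartheta v Q \<ge> 0"
  have "Q \<in> breakpoint_locus m N" if adm: "admissible m N" for m N
    using breakpoint_locus_of_admissible[OF adm] assms pos by metis
  then show "Q \<in> igusa_locus" using assms by (simp add: igusa_locus_def)
qed

lemma (in dicing) Q_in_igusa_locus: "Q \<in> igusa_locus"
proof -
  have "vartheta v Q \<ge> 0" if "v \<noteq> 0" for v
    unfolding vartheta_Q[OF that] by (auto intro!: sum_nonneg intro: less_imp_le l_pos)
  then show ?thesis using igusa_locus_iff[OF Q_in_H4_trop] by blast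
qed

theorem J4_trop_subset_igusa_locus: "J4_trop \<subseteq> igusa_locus"
proof
  fix Q assume "Q \<in> J4_trop"
  then obtain G :: "(nat, nat) pre_digraph" and l and B :: "4 \<Rightarrow> nat \<Rightarrow> int" where
    Q: "Q = riemann_matrix G l B" and G: "metric_graph G l" "cycle_basis G B"
    unfolding J4_trop_def by blast
  interpret dicing "arcs G" l "edge_vector B" using G by (rule cycle_basis_dicing)
  show "Q \<in> igusa_locus"
    unfolding Q riemann_matrix_eq_rank_one_sum by (rule Q_in_igusa_locus)
qed


section \<open>A matrix of the tropical Igusa locus outside the tropical Schottky locus\<close>

text \<open>
  The vectors \<open>e\<^sub>i\<close> and \<open>e\<^sub>i - e\<^sub>j\<close> represent the graphic matroid of the complete graph on the vertices
  \<open>0, 1, 2, 3, 4\<close>, where \<open>e\<^sub>i\<close> stands for the edge from \<open>i\<close> to \<open>0\<close>. Indexing by all pairs lists each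
  edge between \<open>i\<close> and \<open>j \<noteq> i\<close> twice, with opposite signs; this only doubles its length. So the
  matrix \<open>K5.Q\<close> below is the reduced Laplacian of a weighted complete graph.
\<close>

definition K5_vector :: "4 \<times> 4 \<Rightarrow> int ^ 4" where
  "K5_vector e = axis (fst e) 1 - (if fst e = snd e then 0 else axis (snd e) 1)"

text \<open>
  A vector with entries 0 and 1 is its own small lift, as its entries and their differences have
  absolute value at most 1.
\<close>

interpretation K5: dicing UNIV "\<lambda>_. 1" K5_vector
proof
  show "x = 0" if "\<forall>e\<in>UNIV. x \<bullet> real_vec (K5_vector e) = 0" for x :: "real ^ 4"
  proof -
    have "real_vec (K5_vector (i, i)) = axis i 1" for i
      by (simp add: K5_vector_def real_vec_def axis_def vec_eq_iff)
    then have "x $ i = 0" for i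
      using that[THEN bspec, of "(i, i)"] by (simp add: inner_axis)
    then show ?thesis by (simp add: vec_eq_iff)
  qed
  show "\<exists>w. mod2 w = u \<and> (\<forall>e\<in>UNIV. \<bar>idot w (K5_vector e)\<bar> \<le> 1)" for u
  proof (intro exI conjI ballI)
    show "mod2 (lift_int u) = u" by (simp add: mod2_def lift_int_def vec_eq_iff)
    fix e :: "4 \<times> 4"
    have idot_axis: "idot w (axis i 1) = w $ i" for w :: "int ^ 4" and i
    proof -
      have "idot w (axis i 1) = (\<Sum>j\<in>UNIV. if j = i then w $ j else 0)"
        unfolding idot_def by (rule sum.cong) (auto simp: axis_def)
      then show ?thesis by simp
    qed
    have "idot w (x - y) = idot w x - idot w y" for w x y :: "int ^ 4"
      by (simp add: idot_def right_diff_distrib sum_subtractf)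
    moreover have "idot w 0 = 0" for w :: "int ^ 4" by (simp add: idot_def)
    moreover have "lift_int u $ i = 0 \<or> lift_int u $ i = 1" for i
      by (cases "u $ i") (simp_all add: lift_int_def)
    ultimately show "\<bar>idot (lift_int u) (K5_vector e)\<bar> \<le> 1"
      by (simp add: K5_vector_def idot_axis) (metis abs_0 abs_1 abs_minus_cancel diff_0 diff_self diff_zero order_refl zero_le_one)
  qed
qed simp_all

text \<open>
  The ten edges have ten different classes modulo 2, the indicator vectors of the subsets of
  \<open>{1, 2, 3, 4}\<close> with one or two elements.
\<close>

lemma K5_card_vartheta_pos: "card {v. v \<noteq> 0 \<and> vartheta v K5.Q > 0} \<ge> 10"
proof -
  let ?P = "{v. v \<noteq> 0 \<and> vartheta v K5.Q > 0}"
  let ?S = "{S :: 4 set. card S = 1} \<union> {S. card S = 2}"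
  define ind where "ind S = (\<chi> i. (of_bool (i \<in> S) :: bit))" for S :: "4 set"
  have "ind S \<in> ?P" if S: "S \<in> ?S" for S
  proof -
    obtain i j where ij: "S = {i, j}" using S by (auto simp: card_1_singleton_iff card_2_iff)
    have "mod2 (K5_vector (i, j)) = ind S"
      by (auto simp: ij ind_def mod2_def K5_vector_def axis_def vec_eq_iff)
    then have "(\<Sum>e\<in>{e. mod2 (K5_vector e) = ind S}. 1 :: real) > 0"
      by (simp add: card_gt_0_iff) blast
    moreover have "ind S $ i = 1" by (simp add: ind_def ij)
    then have "ind S \<noteq> 0" by auto
    ultimately show ?thesis using K5.vartheta_Q[of "ind S"] by simp
  qed
  moreover have "inj ind"
    by (rule inj_onI) (auto simp: ind_def vec_eq_iff of_bool_eq_iff)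
  ultimately have "card ?S \<le> card ?P"
    by (intro card_inj_on_le[of ind]) (auto intro: inj_on_subset)
  moreover have "card ?S = 10"
  proof -
    have "card ?S = card {S :: 4 set. card S = 1} + card {S :: 4 set. card S = 2}"
      by (rule card_Un_disjoint) auto
    also have "\<dots> = 4 + (4 choose 2)"
      using n_subsets[of "UNIV :: 4 set" 1] n_subsets[of "UNIV :: 4 set" 2] by simp
    finally show ?thesis by (simp add: choose_two)
  qed
  ultimately show ?thesis by simp
qed

theorem theorem4p9:
  shows "(\<forall>Q\<in>H4_trop. Q \<in> igusa_locus \<longleftrightarrow> (\<forall>v. v \<noteq> 0 \<longrightarrow> vartheta v Q \<ge> 0)) \<and>
         J4_trop \<subseteq> igusa_locus \<and> J4_trop \<noteq> igusa_locus"
proof (intro conjI ballI)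
  show "J4_trop \<noteq> igusa_locus"
    using K5.Q_in_igusa_locus K5_card_vartheta_pos J4_trop_card_vartheta_pos by fastforce
qed (fact igusa_locus_iff J4_trop_subset_igusa_locus)+

end
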